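(* The manifold of $n\times n$ CMV matrices with fixed determinant (equal to any given unimodular complex number) forms a symplectic leaf in the Poisson manifold $\mathfrak{g}$ of $n\times n$ complex matrices equipped with the Gelfand--Dikij bracket.
   Context: CMV matrices: given $\alpha_0,\ldots,\alpha_{n-2}$ in the open unit disk $\mathbb{D}$ and $\alpha_{n-1}$ on the unit circle $S^1$, put $\rho_k=\sqrt{1-|\alpha_k|^2}$, $\Xi_k=\begin{bmatrix}\bar\alpha_k&\rho_k\\ \rho_k&-\alpha_k\end{bmatrix}$ for $0\le k\le n-2$, and $1\times1$ matrices $\Xi_{-1}=[1]$, $\Xi_{n-1}=[\bar\alpha_{n-1}]$. The $n\times n$ CMV matrix with these coefficients is $\mathcal{C}=\mathcal{L}\mathcal{M}$, where $\mathcal{L}=\mathrm{diag}(\Xi_0,\Xi_2,\Xi_4,\ldots)$, $\mathcal{M}=\mathrm{diag}(\Xi_{-1},\Xi_1,\Xi_3,\ldots)$ are $n\times n$ block-diagonal. Its determinant is $(-1)^{n-1}\bar\alpha_{n-1}$. Gelfand--Dikij bracket: let $\mathfrak{g}$ be the $n\times n$ complex matrices viewed as a real manifold. Write $\mathfrak{g}=\mathfrak{l}\oplus\mathfrak{a}$ (real vector spaces), with $\mathfrak{a}=\{A:A=-A^\dagger\}$ and $\mathfrak{l}$ the lower triangular matrices with real diagonal entries; $\pi_{\mathfrak l},\pi_{\mathfrak a}$ are the projections onto the summands and $R=\pi_{\mathfrak l}-\pi_{\mathfrak a}$. Let $\langle X,Y\rangle=\mathrm{Im}\,\mathrm{tr}(XY)$,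 and for smooth $\phi:\mathfrak{g}\to\mathbb{R}$ define $\nabla\phi:\mathfrak g\to\mathfrak g$ by $\frac{d}{dt}\big|_{t=0}\phi(B+tC)=\langle\nabla\phi|_B,C\rangle$. The Poisson bracket is, with $X=\nabla\phi|_B$, $Y=\nabla\psi|_B$, $$\{\phi,\psi\}|_B=\tfrac12\langle R(XB),YB\rangle-\tfrac12\langle R(BX),BY\rangle .$$ The symplectic leaf through a point is the set of points reachable from it by finite concatenations of flows of Hamiltonian vector fields. *)

theory Defs
  imports "HOL-Analysis.Analysis"
begin

text \<open>
  The space of complex \<open>n \<times> n\<close> matrices is the type \<open>complex^'n^'n\<close>, abbreviated \<open>'n cmat\<close>, where
  \<open>'n\<close> is a finite linearly ordered type and \<open>n = CARD('n)\<close>. It is a Euclidean space over the reals, so derivatives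
  below are real derivatives.
\<close>

type_synonym 'n cmat = "((complex, 'n) vec, 'n) vec"

section \<open>CMV matrices\<close>

definition pos :: "'n::{finite,linorder} \<Rightarrow> nat" where
  "pos i = card {j. j < i}"

definition rho :: "complex \<Rightarrow> real" where
  "rho a = sqrt (1 - (cmod a)\<^sup>2)"

text \<open>A square block is a pair of its size and its entries, with rows and columns counted from 0.\<close>

type_synonym block = "nat \<times> (nat \<Rightarrow> nat \<Rightarrow> complex)"

fun block_diag :: "block list \<Rightarrow> nat \<Rightarrow> nat \<Rightarrow> complex" where
  "block_diag [] p q = 0"
| "block_diag ((m, A) # bs) p q =
     (if p < m \<and> q < m then A p q
      else if m \<le> p \<and> m \<le> q then block_diag bs (p - m) (q - m)
      else 0)"

definition Xi :: "nat \<Rightarrow> (nat \<Rightarrow> complex) \<Rightarrow> nat \<Rightarrow> block" where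
  "Xi n \<alpha> k =
     (if k = n - 1 then (1, \<lambda>r s. cnj (\<alpha> k))
      else (2, \<lambda>r s. if r = 0 \<and> s = 0 then cnj (\<alpha> k)
                     else if r = 1 \<and> s = 1 then - \<alpha> k
                     else complex_of_real (rho (\<alpha> k))))"

definition cmv_L :: "(nat \<Rightarrow> complex) \<Rightarrow> 'n::{finite,linorder} cmat" where
  "cmv_L \<alpha> = (\<chi> i j. block_diag
     (map (Xi CARD('n) \<alpha>) (filter even [0..<CARD('n)])) (pos i) (pos j))"

text \<open>The leading block of \<open>cmv_M\<close> is \<open>\<Xi>\<^sub>-\<^sub>1 = [1]\<close>.\<close>

definition cmv_M :: "(nat \<Rightarrow> complex) \<Rightarrow> 'n::{finite,linorder} cmat" where
  "cmv_M \<alpha> = (\<chi> i j. block_diag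
     ((1, \<lambda>r s. 1) # map (Xi CARD('n) \<alpha>) (filter odd [0..<CARD('n)])) (pos i) (pos j))"

definition cmv :: "(nat \<Rightarrow> complex) \<Rightarrow> 'n::{finite,linorder} cmat" where
  "cmv \<alpha> = cmv_L \<alpha> ** cmv_M \<alpha>"

definition cmv_coeffs :: "nat \<Rightarrow> (nat \<Rightarrow> complex) \<Rightarrow> bool" where
  "cmv_coeffs n \<alpha> \<longleftrightarrow> (\<forall>k<n - 1. cmod (\<alpha> k) < 1) \<and> cmod (\<alpha> (n - 1)) = 1"

definition cmv_matrices :: "('n::{finite,linorder} cmat) set" where
  "cmv_matrices = {cmv \<alpha> |\<alpha>. cmv_coeffs CARD('n) \<alpha>}"

section \<open>The Gelfand--Dikij bracket\<close>

definition adjoint_mat :: "'n::finite cmat \<Rightarrow> 'n::finite cmat" where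
  "adjoint_mat A = (\<chi> i j. cnj (A $ j $ i))"

definition skew_adjoint :: "('n::finite cmat) set" where
  "skew_adjoint = {A. A = - adjoint_mat A}"

definition lower_real_diag :: "('n::{finite,linorder} cmat) set" where
  "lower_real_diag = {A. (\<forall>i j. i < j \<longrightarrow> A $ i $ j = 0) \<and> (\<forall>i. A $ i $ i \<in> \<real>)}"

definition proj_l :: "'n::{finite,linorder} cmat \<Rightarrow> 'n cmat" where
  "proj_l A = (THE L. L \<in> lower_real_diag \<and> (\<exists>S\<in>skew_adjoint. A = L + S))"

definition proj_a :: "'n::{finite,linorder} cmat \<Rightarrow> 'n cmat" where
  "proj_a A = (THE S. S \<in> skew_adjoint \<and> (\<exists>L\<in>lower_real_diag. A = L + S))"

definition R_op :: "'n::{finite,linorder} cmat \<Rightarrow> 'n cmat" where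
  "R_op A = proj_l A - proj_a A"

definition pairing :: "'n::finite cmat \<Rightarrow> 'n::finite cmat \<Rightarrow> real" where
  "pairing X Y = Im (trace (X ** Y))"

primrec Ck :: "nat \<Rightarrow> ('a::real_normed_vector \<Rightarrow> real) \<Rightarrow> bool" where
  "Ck 0 f \<longleftrightarrow> continuous_on UNIV f"
| "Ck (Suc k) f \<longleftrightarrow> (\<forall>x. f differentiable (at x)) \<and>
     (\<forall>v. Ck k (\<lambda>x. frechet_derivative f (at x) v))"

definition smooth :: "('a::real_normed_vector \<Rightarrow> real) \<Rightarrow> bool" where
  "smooth f \<longleftrightarrow> (\<forall>k. Ck k f)"

definition grad :: "('n::finite cmat \<Rightarrow> real) \<Rightarrow> 'n::finite cmat \<Rightarrow> 'n::finite cmat" where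
  "grad \<phi> B = (THE X. \<forall>C.
     ((\<lambda>t. \<phi> (B + t *\<^sub>R C)) has_real_derivative pairing X C) (at 0))"

definition gd_bracket ::
  "('n::{finite,linorder} cmat \<Rightarrow> real) \<Rightarrow> ('n cmat \<Rightarrow> real) \<Rightarrow> 'n cmat \<Rightarrow> real"
where
  "gd_bracket \<phi> \<psi> B = (let X = grad \<phi> B; Y = grad \<psi> B in
     1/2 * pairing (R_op (X ** B)) (Y ** B) - 1/2 * pairing (R_op (B ** X)) (B ** Y))"

section \<open>Symplectic leaves\<close>

text \<open>
  The Hamiltonian vector field of \<open>\<phi>\<close> is the derivation \<open>\<psi> \<mapsto> {\<psi>, \<phi>}\<close>. The opposite sign
  convention amounts to replacing \<open>\<phi>\<close> by \<open>-\<phi>\<close> and yields the same leaves.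
\<close>

definition hamiltonian_field ::
  "('n::{finite,linorder} cmat \<Rightarrow> real) \<Rightarrow> 'n cmat \<Rightarrow> 'n cmat"
where
  "hamiltonian_field \<phi> B = (THE V. \<forall>\<psi>. smooth \<psi> \<longrightarrow>
     frechet_derivative \<psi> (at B) V = gd_bracket \<psi> \<phi> B)"

text \<open>
  Hamiltonian vector fields need not be complete, so the flow is followed along an integral curve
  on a compact time interval. Negative times are covered by replacing \<open>\<phi>\<close> by \<open>-\<phi>\<close>.
\<close>

definition hamiltonian_flow ::
  "'n::{finite,linorder} cmat \<Rightarrow> 'n cmat \<Rightarrow> bool"
where
  "hamiltonian_flow B B' \<longleftrightarrow> (\<exists>\<phi> \<gamma> T. smooth \<phi> \<and> 0 \<le> T \<and> \<gamma> 0 = B \<and> \<gamma> T = B' \<and>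
     (\<forall>t\<in>{0..T}. (\<gamma> has_vector_derivative hamiltonian_field \<phi> (\<gamma> t)) (at t within {0..T})))"

definition symplectic_leaf ::
  "'n::{finite,linorder} cmat \<Rightarrow> ('n cmat) set"
where
  "symplectic_leaf B = {B'. hamiltonian_flow\<^sup>*\<^sup>* B B'}"

definition is_symplectic_leaf :: "('n::{finite,linorder} cmat) set \<Rightarrow> bool" where
  "is_symplectic_leaf S \<longleftrightarrow> (\<exists>B. S = symplectic_leaf B)"

end

theory Submission
  imports Defs
begin

text \<open>
  For a Hamiltonian with gradient \<open>Y\<close> the field at \<open>B\<close> is
  \<open>B \<pi>\<^sub>a(YB) - \<pi>\<^sub>a(BY) B = \<pi>\<^sub>l(BY) B - B \<pi>\<^sub>l(YB)\<close>. The first form shows that flows preserve unitarity and the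
  determinant. The second shows that they preserve every zero pattern closed upwards and to the right, and
  rescale the entries at its corners by positive reals; for unitary \<open>B\<close> the same holds for the adjoint,
  which gives the patterns in the other direction. Unitary matrices with the zero pattern of a CMV matrix and positive
  corner entries are exactly the CMV matrices: the coefficients can be peeled off one by one.
  Conversely, write a CMV matrix as \<open>U \<Xi>\<^sub>k W\<close> with \<open>U\<close>, \<open>W\<close> unitary and block diagonal with a cut inside
  \<open>\<Xi>\<^sub>k\<close>. A suitable quadratic Hamiltonian moves only \<open>\<alpha>\<^sub>k\<close>, with velocity \<open>c \<rho>\<^sub>k\<^sup>2\<close>, hence
  along \<open>c tanh t\<close> if \<open>|c| = 1\<close>; so every CMV matrix is reached from the one in which
  all coefficients but the last vanish.
\<close>

section \<open>Matrix algebra and the trace pairing\<close>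

text \<open>An arbitrary Hamiltonian flow cannot be followed in the coefficients \<alpha>, because
  it is not known beforehand to stay among CMV matrices. Unitarity, zeros and signs can be tested on
  any matrix, and each of them reduces along the flow to a quantity whose derivative vanishes. For
  the converse, the Hamiltonian must make both projections computable. The leading principal minor
  that cuts through the block does this: for its gradient Y, both YB and BY are a scalar on the
  coordinates before the cut plus a strictly triangular term, and unitary factors that respect the
  cut preserve this form. The coefficient then approaches the unit circle without reaching it, so
  every point of the open disk lies at a finite travel time. Reachability is directed, so the leaf
  is described from a base point from which outgoing curves suffice. Determinants are evaluated at
  base points only; every other value follows from invariance.\<close>

lemma mat_mult_nth: "(A ** B) $ i $ j = (\<Sum>k\<in>UNIV. A $ i $ k * B $ k $ j)"
  by (simp add: matrix_matrix_mult_def)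

lemma mat_add_mult: "(A + B) ** C = A ** C + B ** (C :: 'n::finite cmat)"
  by (vector matrix_matrix_mult_def sum.distrib distrib_right)

lemma mat_diff_mult: "(A - B) ** C = A ** C - B ** (C :: 'n::finite cmat)"
  by (vector matrix_matrix_mult_def sum_subtractf left_diff_distrib)

lemma mat_mult_diff: "A ** (B - C) = A ** B - A ** (C :: 'n::finite cmat)"
  by (vector matrix_matrix_mult_def sum_subtractf right_diff_distrib)

lemma mat_mult_uminus: "A ** (- C) = - (A ** (C :: 'n::finite cmat))"
  by (vector matrix_matrix_mult_def sum_negf)

lemma mat_uminus_mult: "(- A) ** C = - (A ** (C :: 'n::finite cmat))"
  by (vector matrix_matrix_mult_def sum_negf)

lemma mat_scaleR_mult: "(r *\<^sub>R A) ** C = r *\<^sub>R (A ** (C :: 'n::finite cmat))"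
  by (vector matrix_matrix_mult_def scaleR_sum_right)

lemma mat_mult_scaleR: "A ** (r *\<^sub>R C) = r *\<^sub>R (A ** (C :: 'n::finite cmat))"
  by (vector matrix_matrix_mult_def scaleR_sum_right)

lemma bounded_bilinear_mat_mult:
  "bounded_bilinear ((**) :: 'n::finite cmat \<Rightarrow> 'n cmat \<Rightarrow> 'n cmat)"
  unfolding bilinear_conv_bounded_bilinear[symmetric] bilinear_def
  by (auto intro!: linearI
      simp: matrix_add_ldistrib mat_add_mult mat_scaleR_mult mat_mult_scaleR)

lemmas has_vector_derivative_mat_mult =
  bounded_bilinear.has_vector_derivative[OF bounded_bilinear_mat_mult]

lemmas continuous_on_mat_mult = bounded_bilinear.continuous_on[OF bounded_bilinear_mat_mult]

lemma adjoint_mat_mult: "adjoint_mat (A ** B) = adjoint_mat B ** adjoint_mat A"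
  by (vector adjoint_mat_def matrix_matrix_mult_def mult.commute)

lemma adjoint_mat_adjoint_mat [simp]: "adjoint_mat (adjoint_mat A) = A"
  by (vector adjoint_mat_def)

lemma adjoint_mat_diff: "adjoint_mat (A - B) = adjoint_mat A - adjoint_mat B"
  by (vector adjoint_mat_def)

lemma adjoint_mat_one [simp]: "adjoint_mat (mat 1) = (mat 1 :: 'n::finite cmat)"
  by (auto simp: adjoint_mat_def mat_def vec_eq_iff)

lemma bounded_linear_adjoint_mat:
  "bounded_linear (adjoint_mat :: 'n::finite cmat \<Rightarrow> 'n cmat)"
  unfolding linear_conv_bounded_linear[symmetric]
  by (rule linearI) (auto simp: adjoint_mat_def vec_eq_iff)

definition unitary :: "'n::finite cmat \<Rightarrow> bool" where
  "unitary A \<longleftrightarrow> adjoint_mat A ** A = mat 1"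

lemma unitaryD: "unitary A \<Longrightarrow> adjoint_mat A ** A = mat 1"
  "unitary A \<Longrightarrow> A ** adjoint_mat A = mat 1"
  by (simp_all add: unitary_def matrix_left_right_inverse)

lemma unitary_adjoint [simp]: "unitary (adjoint_mat A) \<longleftrightarrow> unitary A"
  by (simp add: unitary_def matrix_left_right_inverse)

lemma unitary_mult: "unitary A \<Longrightarrow> unitary B \<Longrightarrow> unitary (A ** B)"
  unfolding unitary_def adjoint_mat_mult
  by (metis matrix_mul_assoc matrix_mul_rid)

lemma unitary_one [simp]: "unitary (mat 1)"
  by (simp add: unitary_def)

lemma trace_mult_sum: "trace (A ** B) = (\<Sum>i\<in>UNIV. \<Sum>j\<in>UNIV. A $ i $ j * B $ j $ i)"
  by (simp add: trace_def mat_mult_nth)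

lemma pairing_add_left: "pairing (X + Y) Z = pairing X Z + pairing Y (Z :: 'n::finite cmat)"
  by (simp add: pairing_def mat_add_mult trace_add)

lemma pairing_diff_left: "pairing (X - Y) Z = pairing X Z - pairing Y (Z :: 'n::finite cmat)"
  by (simp add: pairing_def mat_diff_mult trace_sub)

lemma pairing_add_right: "pairing X (Y + Z) = pairing X Y + pairing X (Z :: 'n::finite cmat)"
  by (simp add: pairing_def matrix_add_ldistrib trace_add)

lemma pairing_diff_right: "pairing X (Y - Z) = pairing X Y - pairing X (Z :: 'n::finite cmat)"
  by (simp add: pairing_def mat_mult_diff trace_sub)

lemma pairing_commute: "pairing X Y = pairing Y (X :: 'n::finite cmat)"
  unfolding pairing_def by (subst trace_mul_sym) (rule refl)

lemma pairing_mult_left: "pairing (X ** Y) Z = pairing X (Y ** (Z :: 'n::finite cmat))"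
  by (simp add: pairing_def matrix_mul_assoc)

lemma pairing_mult_right: "pairing (X ** Y) Z = pairing Y (Z ** (X :: 'n::finite cmat))"
  by (metis pairing_commute pairing_mult_left)

lemma pairing_scaleR_right: "pairing X (r *\<^sub>R Y) = r * pairing X (Y :: 'n::finite cmat)"
  by (simp add: pairing_def mat_mult_scaleR trace_def sum_distrib_left)

lemma bounded_linear_pairing: "bounded_linear (pairing (X :: 'n::finite cmat))"
  unfolding linear_conv_bounded_linear[symmetric]
  by (rule linearI) (simp_all only: pairing_add_right pairing_scaleR_right real_scaleR_def)

section \<open>Real linear functionals as pairings\<close>

definition elem_mat :: "'n \<Rightarrow> 'n \<Rightarrow> complex \<Rightarrow> 'n::finite cmat" where
  "elem_mat i j z = (\<chi> p q. if p = i \<and> q = j then z else 0)"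

lemma elem_mat_nth: "elem_mat i j z $ p $ q = (if p = i \<and> q = j then z else 0)"
  by (simp add: elem_mat_def)

lemma pairing_elem_mat: "pairing X (elem_mat j i z) = Im (X $ i $ j * z)"
proof -
  have "trace (X ** elem_mat j i z) = (\<Sum>p\<in>UNIV. if p = i then X $ i $ j * z else 0)"
    unfolding trace_mult_sum
  proof (rule sum.cong)
    fix p
    have "(\<Sum>q\<in>UNIV. X $ p $ q * elem_mat j i z $ q $ p) =
        (\<Sum>q\<in>UNIV. if q = j then (if p = i then X $ i $ j * z else 0) else 0)"
      by (rule sum.cong) (auto simp: elem_mat_nth)
    also have "\<dots> = (if p = i then X $ i $ j * z else 0)" by simp
    finally show "(\<Sum>q\<in>UNIV. X $ p $ q * elem_mat j i z $ q $ p) = (if p = i then X $ i $ j * z else 0)" .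
  qed simp
  thus ?thesis by (simp add: pairing_def)
qed

text \<open>Nondegeneracy of the pairing: testing against \<open>elem_mat j i 1\<close> reads off
  the imaginary part of the (i, j) entry, testing against \<open>elem_mat j i \<i>\<close> the real
  part.\<close>

lemma pairing_eqI:
  assumes "\<And>C. pairing X C = pairing Y (C :: 'n::finite cmat)"
  shows "X = Y"
proof -
  have "X $ i $ j = Y $ i $ j" for i j
    using assms[of "elem_mat j i 1"] assms[of "elem_mat j i \<i>"]
    by (simp add: pairing_elem_mat complex_eq_iff)
  thus ?thesis by (simp add: vec_eq_iff)
qed

lemma elem_mat_sum:
  "A = (\<Sum>i\<in>UNIV. \<Sum>j\<in>UNIV. Re (A $ i $ j) *\<^sub>R elem_mat i j 1 + Im (A $ i $ j) *\<^sub>R elem_mat i j \<i>)"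
proof -
  have "(\<Sum>i\<in>UNIV. \<Sum>j\<in>UNIV. Re (A $ i $ j) *\<^sub>R elem_mat i j 1 + Im (A $ i $ j) *\<^sub>R elem_mat i j \<i>) $ p $ q
    = A $ p $ q" for p q
  proof -
    have "(\<Sum>i\<in>UNIV. \<Sum>j\<in>UNIV. Re (A $ i $ j) *\<^sub>R elem_mat i j 1 + Im (A $ i $ j) *\<^sub>R elem_mat i j \<i>) $ p $ q
      = (\<Sum>i\<in>UNIV. \<Sum>j\<in>UNIV. if j = q then (if i = p then A $ p $ q else 0) else 0)"
      unfolding sum_component
      by (intro sum.cong refl) (auto simp: elem_mat_nth complex_eq_iff)
    thus ?thesis by simp
  qed
  thus ?thesis by (simp add: vec_eq_iff)
qed

lemma linear_functional_pairing:
  fixes f :: "'n::finite cmat \<Rightarrow> real"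
  assumes "linear f"
  shows "f = pairing (\<chi> i j. Complex (f (elem_mat j i \<i>)) (f (elem_mat j i 1)))"
proof
  fix C
  interpret linear f by fact
  let ?X = "\<chi> i j. Complex (f (elem_mat j i \<i>)) (f (elem_mat j i 1))"
  have "f C = (\<Sum>i\<in>UNIV. \<Sum>j\<in>UNIV. Re (C $ i $ j) * f (elem_mat i j 1) + Im (C $ i $ j) * f (elem_mat i j \<i>))"
    by (subst elem_mat_sum) (simp add: sum add scale)
  also have "\<dots> = (\<Sum>i\<in>UNIV. \<Sum>j\<in>UNIV. Im (C $ i $ j * ?X $ j $ i))"
    by (intro sum.cong refl) simp
  also have "\<dots> = pairing C ?X"
    by (simp add: pairing_def trace_mult_sum)
  finally show "f C = pairing ?X C" by (simp add: pairing_commute)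
qed

section \<open>The projections\<close>

text \<open>Closed formula for the projection onto the skew-adjoint summand. The other summand
  contributes nothing above the diagonal and nothing imaginary on it, so these data belong to the
  skew part, and skewness fixes the rest.\<close>

definition anti_part :: "'n::{finite,linorder} cmat \<Rightarrow> 'n cmat" where
  "anti_part A = (\<chi> i j. if i < j then A $ i $ j else if j < i then - cnj (A $ j $ i)
     else \<i> * Im (A $ i $ i))"

lemma anti_part_skew: "anti_part A \<in> skew_adjoint"
  by (auto simp: skew_adjoint_def anti_part_def adjoint_mat_def vec_eq_iff)

lemma anti_part_adjoint: "adjoint_mat (anti_part A) = - anti_part A"
  by (auto simp: anti_part_def adjoint_mat_def vec_eq_iff)

lemma diff_anti_part_lower: "A - anti_part A \<in> lower_real_diag"
  by (auto simp: lower_real_diag_def anti_part_def complex_is_Real_iff)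

lemma lower_skew_decomp_unique:
  assumes "L \<in> lower_real_diag" "S \<in> skew_adjoint" "A = L + S"
  shows "S = anti_part A"
proof -
  have S: "S $ i $ j = - cnj (S $ j $ i)" for i j
  proof -
    have "S $ i $ j = (- adjoint_mat S) $ i $ j"
      using assms(2) by (simp add: skew_adjoint_def)
    thus ?thesis by (simp add: adjoint_mat_def)
  qed
  have "S $ i $ j = anti_part A $ i $ j" for i j
  proof (cases i j rule: linorder_cases)
    case less
    thus ?thesis using assms by (auto simp: anti_part_def lower_real_diag_def)
  next
    case equal
    have "Re (S $ i $ i) = 0" using arg_cong[OF S[of i i], of Re] by simp
    thus ?thesis using assms equal
      by (auto simp: anti_part_def lower_real_diag_def complex_eq_iff complex_is_Real_iff)
  next
    case greater
    thus ?thesis using assms S[of i j] by (auto simp: anti_part_def lower_real_diag_def)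
  qed
  thus ?thesis by (simp add: vec_eq_iff)
qed

lemma proj_a_eq: "proj_a A = anti_part A"
  unfolding proj_a_def
proof (rule the_equality)
  show "anti_part A \<in> skew_adjoint \<and> (\<exists>L\<in>lower_real_diag. A = L + anti_part A)"
    using diff_anti_part_lower[of A] anti_part_skew[of A] by (metis diff_add_cancel)
qed (auto dest: lower_skew_decomp_unique)

lemma proj_l_eq: "proj_l A = A - anti_part A"
  unfolding proj_l_def
proof (rule the_equality)
  show "A - anti_part A \<in> lower_real_diag \<and> (\<exists>S\<in>skew_adjoint. A = A - anti_part A + S)"
    using diff_anti_part_lower[of A] anti_part_skew[of A] by (metis diff_add_cancel)
qed (metis lower_skew_decomp_unique add_diff_cancel_right')

lemma R_op_eq: "R_op A = A - 2 *\<^sub>R anti_part A"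
  by (simp add: R_op_def proj_a_eq proj_l_eq scaleR_2)

lemma bounded_linear_anti_part:
  "bounded_linear (anti_part :: 'n::{finite,linorder} cmat \<Rightarrow> 'n cmat)"
  unfolding linear_conv_bounded_linear[symmetric]
  by (rule linearI) (auto simp: anti_part_def vec_eq_iff complex_eq_iff)

lemma pairing_skew_skew:
  assumes "adjoint_mat A = - A" "adjoint_mat B = - B"
  shows "pairing A B = 0"
proof -
  have "cnj (trace (A ** B)) = trace (adjoint_mat (A ** B))"
    by (simp add: trace_def adjoint_mat_def)
  also have "\<dots> = trace (A ** B)"
    by (simp add: adjoint_mat_mult assms mat_mult_uminus mat_uminus_mult trace_mul_sym[of B A])
  finally show ?thesis by (simp add: pairing_def complex_eq_iff)
qed

lemma pairing_lower_lower:
  assumes "A \<in> lower_real_diag" "B \<in> lower_real_diag"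
  shows "pairing A B = 0"
proof -
  have "Im (A $ i $ j * B $ j $ i) = 0" for i j
    using assms by (cases i j rule: linorder_cases)
      (auto simp: lower_real_diag_def complex_is_Real_iff)
  thus ?thesis by (simp add: pairing_def trace_mult_sum)
qed

text \<open>Both summands of the decomposition are isotropic for the pairing, so only mixed terms
  survive. In this form P occurs undecomposed, which allows a gradient to be isolated in the
  bracket.\<close>

lemma pairing_R_op: "pairing (R_op P) Q = 2 * pairing P (anti_part Q) - pairing P Q"
proof -
  have 1: "pairing (anti_part P) (anti_part Q) = 0"
    by (simp add: pairing_skew_skew anti_part_adjoint)
  have 2: "pairing (P - anti_part P) (Q - anti_part Q) = 0"
    by (simp add: pairing_lower_lower diff_anti_part_lower)
  have 3: "pairing (2 *\<^sub>R anti_part P) Q = 2 * pairing (anti_part P) Q"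
    by (simp only: scaleR_2 pairing_add_left mult_2)
  show ?thesis
    using 1 2 3 by (simp add: R_op_eq pairing_diff_left pairing_diff_right)
qed

section \<open>Smooth functions and Hamiltonian vector fields\<close>

lemma smooth_Ck: "smooth f \<Longrightarrow> Ck k f"
  by (simp add: smooth_def)

lemma smooth_differentiable: "smooth f \<Longrightarrow> f differentiable (at x)"
  by (drule smooth_Ck[of _ "Suc 0"]) simp

lemma smooth_continuous_derivative:
  "smooth f \<Longrightarrow> continuous_on UNIV (\<lambda>x. frechet_derivative f (at x) v)"
  by (drule smooth_Ck[of _ "Suc 0"]) simp

text \<open>Allows smoothness of a polynomial to be shown by descending in the degree: quadratic
  functions have affine derivatives, and affine ones have constant derivatives.\<close>

lemma smoothI:
  assumes "\<And>x. f differentiable (at x)"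
    and "\<And>v. smooth (\<lambda>x. frechet_derivative f (at x) v)"
  shows "smooth f"
  unfolding smooth_def
proof
  fix k
  show "Ck k f"
  proof (cases k)
    case 0
    have "continuous_on UNIV f"
      using assms(1) by (simp add: continuous_on_eq_continuous_at differentiable_imp_continuous_within)
    thus ?thesis using 0 by simp
  next
    case (Suc m)
    thus ?thesis using assms by (simp add: smooth_def)
  qed
qed

lemma smooth_const: "smooth (\<lambda>x. c)"
proof -
  have "Ck k (\<lambda>x::'a. c)" for k c
    by (induction k arbitrary: c) (auto simp: frechet_derivative_const)
  thus ?thesis by (simp add: smooth_def)
qed

lemma smooth_affine:
  assumes "bounded_linear l"
  shows "smooth (\<lambda>x. l x + c)"
proof (rule smoothI)
  have d: "((\<lambda>x. l x + c) has_derivative l) (at x)" for x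
    using assms by (auto intro!: derivative_eq_intros bounded_linear_imp_has_derivative)
  show "(\<lambda>x. l x + c) differentiable at x" for x
    using d differentiableI by blast
  show "smooth (\<lambda>x. frechet_derivative (\<lambda>x. l x + c) (at x) v)" for v
    using smooth_const[of "l v"] by (simp add: frechet_derivative_at[OF d, symmetric])
qed

lemma smooth_bilinear_linear:
  fixes b :: "'a::real_normed_vector \<Rightarrow> 'a \<Rightarrow> real"
  assumes b: "bounded_bilinear b" and l: "bounded_linear l"
  shows "smooth (\<lambda>x. b x x + l x)"
proof (rule smoothI)
  have d: "((\<lambda>x. b x x + l x) has_derivative (\<lambda>v. b x v + b v x + l v)) (at x)" for x
    using bounded_bilinear.FDERIV[OF b has_derivative_ident has_derivative_ident]
      bounded_linear_imp_has_derivative[OF l] by (auto intro!: derivative_eq_intros)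
  show "(\<lambda>x. b x x + l x) differentiable at x" for x
    using d differentiableI by blast
  show "smooth (\<lambda>x. frechet_derivative (\<lambda>x. b x x + l x) (at x) v)" for v
    using smooth_affine[of "\<lambda>x. b x v + b v x" "l v"]
    by (simp add: frechet_derivative_at[OF d, symmetric] bounded_linear_add
        bounded_bilinear.bounded_linear_left[OF b] bounded_bilinear.bounded_linear_right[OF b])
qed

lemma has_real_derivative_along_line:
  assumes "(f has_derivative D) (at B)"
  shows "((\<lambda>t. f (B + t *\<^sub>R C)) has_real_derivative D C) (at 0)"
proof -
  interpret bounded_linear D using assms by (rule has_derivative_bounded_linear)
  have "((\<lambda>t. f (B + t *\<^sub>R C)) has_derivative (\<lambda>t. D (t *\<^sub>R C))) (at 0)"
    by (rule has_derivative_compose[of "\<lambda>t. B + t *\<^sub>R C" "\<lambda>t. t *\<^sub>R C" 0 UNIV f D, simplified])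
      (use assms in \<open>auto intro!: derivative_eq_intros\<close>)
  thus ?thesis by (simp add: has_field_derivative_def scaleR mult.commute[of _ "D C"])
qed

lemma grad_eqI:
  assumes "(\<phi> has_derivative pairing X) (at B)"
  shows "grad \<phi> B = X"
  unfolding grad_def
proof (rule the_equality)
  show d: "\<forall>C. ((\<lambda>t. \<phi> (B + t *\<^sub>R C)) has_real_derivative pairing X C) (at 0)"
    using assms by (blast intro: has_real_derivative_along_line)
  fix Y assume "\<forall>C. ((\<lambda>t. \<phi> (B + t *\<^sub>R C)) has_real_derivative pairing Y C) (at 0)"
  with d show "Y = X" by (blast intro: pairing_eqI DERIV_unique)
qed

text \<open>The explicit entries exhibit the gradient as a matrix of directional derivatives, which
  makes its continuity accessible.\<close>

lemma grad_frechet: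
  assumes "\<phi> differentiable (at B)"
  shows "grad \<phi> B = (\<chi> i j. Complex (frechet_derivative \<phi> (at B) (elem_mat j i \<i>))
    (frechet_derivative \<phi> (at B) (elem_mat j i 1)))"
    and "frechet_derivative \<phi> (at B) = pairing (grad \<phi> B)"
proof -
  have d: "(\<phi> has_derivative frechet_derivative \<phi> (at B)) (at B)"
    using assms frechet_derivative_works by blast
  hence "linear (frechet_derivative \<phi> (at B))"
    using has_derivative_bounded_linear bounded_linear.linear by blast
  note l = linear_functional_pairing[OF this]
  show 1: "grad \<phi> B = (\<chi> i j. Complex (frechet_derivative \<phi> (at B) (elem_mat j i \<i>))
    (frechet_derivative \<phi> (at B) (elem_mat j i 1)))"
    using d by (subst (asm) l) (rule grad_eqI)
  show "frechet_derivative \<phi> (at B) = pairing (grad \<phi> B)"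
    unfolding 1 by (rule l)
qed

text \<open>Needed to integrate diagonal entries of projected gradients along a flow line.\<close>

lemma continuous_on_grad:
  assumes "smooth \<phi>"
  shows "continuous_on UNIV (grad \<phi>)"
proof -
  have "grad \<phi> = (\<lambda>B. \<chi> i j. Complex (frechet_derivative \<phi> (at B) (elem_mat j i \<i>))
    (frechet_derivative \<phi> (at B) (elem_mat j i 1)))"
    by (intro ext grad_frechet(1) smooth_differentiable assms)
  thus ?thesis
    by (auto simp: Complex_eq intro!: continuous_intros smooth_continuous_derivative assms)
qed

text \<open>The two undecomposed terms agree by cyclicity of the trace and cancel. The remainder is
  linear in the gradient of \<psi>, so the matrix it is paired with is the Hamiltonian vector field
  of \<phi>.\<close>

lemma gd_bracket_eq:
  "gd_bracket \<psi> \<phi> B = pairing (grad \<psi> B)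
     (B ** anti_part (grad \<phi> B ** B) - anti_part (B ** grad \<phi> B) ** B)"
proof -
  define X Y where "X = grad \<psi> B" and "Y = grad \<phi> B"
  have "pairing (X ** B) (Y ** B) = pairing (B ** X) (B ** Y)"
    by (metis pairing_mult_left pairing_mult_right matrix_mul_assoc)
  moreover have "pairing (X ** B) (anti_part (Y ** B)) = pairing X (B ** anti_part (Y ** B))"
    by (rule pairing_mult_left)
  moreover have "pairing (B ** X) (anti_part (B ** Y)) = pairing X (anti_part (B ** Y) ** B)"
    by (rule pairing_mult_right)
  ultimately show ?thesis
    unfolding X_def[symmetric] Y_def[symmetric] gd_bracket_def Let_def pairing_R_op pairing_diff_right
    by (simp add: field_simps)
qed

lemma hamiltonian_field_eq:
  assumes "smooth \<phi>"
  shows "hamiltonian_field \<phi> B =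
    B ** anti_part (grad \<phi> B ** B) - anti_part (B ** grad \<phi> B) ** B" (is "_ = ?V")
  unfolding hamiltonian_field_def
proof (rule the_equality)
  show "\<forall>\<psi>. smooth \<psi> \<longrightarrow> frechet_derivative \<psi> (at B) ?V = gd_bracket \<psi> \<phi> B"
    by (simp add: grad_frechet(2) smooth_differentiable gd_bracket_eq)
next
  fix V assume V: "\<forall>\<psi>. smooth \<psi> \<longrightarrow> frechet_derivative \<psi> (at B) V = gd_bracket \<psi> \<phi> B"
  show "V = ?V"
  proof (rule pairing_eqI)
    \<comment> \<open>The linear functions \<open>pairing X\<close> have constant gradient X;
      testing against all of them determines V by nondegeneracy.\<close>
    fix X :: "'a cmat"
    have s: "smooth (pairing X)"
      using smooth_affine[OF bounded_linear_pairing, of X 0] by simp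
    have "grad (pairing X) B = X"
      by (intro grad_eqI bounded_linear_imp_has_derivative bounded_linear_pairing)
    moreover have "frechet_derivative (pairing X) (at B) = pairing (grad (pairing X) B)"
      using s by (intro grad_frechet smooth_differentiable)
    ultimately have "pairing X V = pairing X ?V"
      using V s by (metis gd_bracket_eq)
    thus "pairing V X = pairing ?V X" by (simp add: pairing_commute)
  qed
qed

section \<open>Products of embedded blocks\<close>

lemma pos_less_iff: "pos i < pos j \<longleftrightarrow> i < (j :: 'n::{finite,linorder})"
proof -
  have *: "pos i < pos j" if "i < j" for i j :: 'n
    unfolding pos_def using that by (intro psubset_card_mono) auto
  show ?thesis
    using *[of i j] *[of j i] by (cases i j rule: linorder_cases) auto
qed

lemma pos_le_iff: "pos i \<le> pos j \<longleftrightarrow> i \<le> (j :: 'n::{finite,linorder})"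
  using pos_less_iff[of j i] by auto

lemma pos_eq_iff [simp]: "pos i = pos j \<longleftrightarrow> i = (j :: 'n::{finite,linorder})"
  using pos_le_iff by (metis order_antisym order_refl)

lemma pos_bij: "bij_betw pos (UNIV :: 'n::{finite,linorder} set) {..<CARD('n)}"
proof -
  have "pos ` (UNIV :: 'n set) \<subseteq> {..<CARD('n)}"
    unfolding pos_def by (auto intro!: psubset_card_mono)
  moreover have inj: "inj (pos :: 'n \<Rightarrow> nat)" by (simp add: inj_def)
  ultimately have "pos ` (UNIV :: 'n set) = {..<CARD('n)}"
    by (intro card_subset_eq) (simp_all add: card_image)
  with inj show ?thesis by (simp add: bij_betw_def)
qed

lemma pos_less_card: "pos (i :: 'n::{finite,linorder}) < CARD('n)"
  using pos_bij bij_betwE by blast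

lemma pos_surj:
  assumes "k < CARD('n)"
  obtains i :: "'n::{finite,linorder}" where "pos i = k"
  using bij_betw_imp_surj_on[OF pos_bij[where 'n="'n::{finite,linorder}"]] assms by (metis imageE lessThan_iff)

text \<open>Entries of the product of the blocks \<Xi>_k with k in K, each embedded on the indices k
  and k + 1 of an identity matrix; this reading is meant for K without neighbours. Restriction to
  indices below n truncates the block at n - 1 to its entry \<open>cnj (\<alpha> (n - 1))\<close>,
  and index 0 receives the entry 1 if 0 is not in K, so the one-by-one blocks at both ends are
  covered by the same formula.\<close>

definition xi_entry :: "nat set \<Rightarrow> (nat \<Rightarrow> complex) \<Rightarrow> nat \<Rightarrow> nat \<Rightarrow> complex" where
  "xi_entry K \<alpha> p q =
     (if p = q then (if p \<in> K then cnj (\<alpha> p) else if 0 < p \<and> p - 1 \<in> K then - \<alpha> (p - 1) else 1)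
      else if q = Suc p \<and> p \<in> K then of_real (rho (\<alpha> p))
      else if p = Suc q \<and> q \<in> K then of_real (rho (\<alpha> q))
      else 0)"

definition xi_diag :: "nat set \<Rightarrow> (nat \<Rightarrow> complex) \<Rightarrow> 'n::{finite,linorder} cmat" where
  "xi_diag K \<alpha> = (\<chi> i j. xi_entry K \<alpha> (pos i) (pos j))"

lemma xi_diag_nth: "xi_diag K \<alpha> $ i $ j = xi_entry K \<alpha> (pos i) (pos j)"
  by (simp add: xi_diag_def)

lemma xi_entry_cong:
  assumes "p \<in> K \<longleftrightarrow> p \<in> K'" "q \<in> K \<longleftrightarrow> q \<in> K'" "p - 1 \<in> K \<longleftrightarrow> p - 1 \<in> K'"
    and "\<And>r. r \<in> K \<Longrightarrow> r \<in> {p, q, p - 1} \<Longrightarrow> \<alpha> r = \<beta> r"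
  shows "xi_entry K \<alpha> p q = xi_entry K' \<beta> p q"
  using assms unfolding xi_entry_def by (cases "p = q") auto

text \<open>Each step strips the block starting at k and continues at k + 2, so the starting index
  keeps its parity e. The offsets p - k and q - k match the index shift in
  \<open>block_diag\<close>.\<close>

lemma block_diag_Xi:
  assumes "k \<le> p" "k \<le> q" "p < n" "q < n" "even k = e"
  shows "block_diag (map (Xi n \<alpha>) (filter (\<lambda>l. even l = e) [k..<n])) (p - k) (q - k) =
    xi_entry {l. even l = e \<and> k \<le> l} \<alpha> p q"
  using assms
proof (induction "n - k" arbitrary: k rule: less_induct)
  case less
  show ?case
  proof (cases "Suc k = n")
    case True
    hence pk: "p = k" "q = k" "[k..<n] = [k]" "k = n - 1" using less.prems by auto
    have "Xi n \<alpha> k = (1, \<lambda>r s. cnj (\<alpha> k))" by (simp add: Xi_def pk(4))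
    thus ?thesis using less.prems(5) by (simp add: pk(1-3) xi_entry_def)
  next
    case False
    hence n: "Suc k < n" using less.prems by simp
    hence l: "[k..<n] = k # Suc k # [k + 2..<n]"
      by (simp add: upt_conv_Cons)
    have f: "filter (\<lambda>l. even l = e) [k..<n] = k # filter (\<lambda>l. even l = e) [k + 2..<n]"
      unfolding l using less.prems by auto
    have IH: "block_diag (map (Xi n \<alpha>) (filter (\<lambda>l. even l = e) [k + 2..<n])) (p - k - 2) (q - k - 2) =
        xi_entry {l. even l = e \<and> k \<le> l} \<alpha> p q" if "k + 2 \<le> p" "k + 2 \<le> q"
    proof -
      have "block_diag (map (Xi n \<alpha>) (filter (\<lambda>l. even l = e) [k + 2..<n])) (p - (k + 2)) (q - (k + 2)) =
        xi_entry {l. even l = e \<and> k + 2 \<le> l} \<alpha> p q"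
        using that less.prems n by (intro less.hyps) auto
      also have "\<dots> = xi_entry {l. even l = e \<and> k \<le> l} \<alpha> p q"
      proof -
        \<comment> \<open>An entry also depends on whether p - 1 belongs to the index set, and p - 1
          may equal k + 1; that index has the wrong parity and lies in neither set.\<close>
        have "p - 1 \<noteq> Suc k" if "even (p - 1) = e"
          using that less.prems(5) by (metis even_Suc)
        thus ?thesis using that by (intro xi_entry_cong) auto
      qed
      finally show ?thesis by simp
    qed
    have XI: "Xi n \<alpha> k = (2, \<lambda>r s. if r = 0 \<and> s = 0 then cnj (\<alpha> k)
        else if r = 1 \<and> s = 1 then - \<alpha> k else of_real (rho (\<alpha> k)))"
      using n by (auto simp: Xi_def)
    consider "k + 2 \<le> p \<and> k + 2 \<le> q" | "p \<in> {k, Suc k} \<and> q \<in> {k, Suc k}"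
      | "p \<in> {k, Suc k} \<and> k + 2 \<le> q" | "k + 2 \<le> p \<and> q \<in> {k, Suc k}"
      using less.prems by force
    thus ?thesis
    proof cases
      case 1
      hence "2 \<le> p - k" "2 \<le> q - k" by auto
      thus ?thesis unfolding f using IH 1 by (simp add: XI)
    next
      case 2
      hence "p = k \<or> p = Suc k" "q = k \<or> q = Suc k" by auto
      thus ?thesis unfolding f using less.prems(5)
        by (elim disjE; simp add: xi_entry_def XI)
    next
      case 3
      hence "p - k < 2" "2 \<le> q - k" by auto
      thus ?thesis unfolding f using 3 less.prems(5) n by (auto simp: XI xi_entry_def)
    next
      case 4
      hence "q - k < 2" "2 \<le> p - k" by auto
      thus ?thesis unfolding f using 4 less.prems(5) n by (auto simp: XI xi_entry_def)
    qed
  qed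
qed

lemma xi_diag_cong:
  assumes "K \<inter> {..<CARD('n)} = K' \<inter> {..<CARD('n)}"
    and "\<And>k. k \<in> K \<Longrightarrow> k < CARD('n) \<Longrightarrow> \<alpha> k = \<beta> k"
  shows "xi_diag K \<alpha> = (xi_diag K' \<beta> :: 'n::{finite,linorder} cmat)"
proof -
  have K: "p \<in> K \<longleftrightarrow> p \<in> K'" if "p < CARD('n)" for p
    using assms(1) that by auto
  have "xi_entry K \<alpha> p q = xi_entry K' \<beta> p q" if "p < CARD('n)" "q < CARD('n)" for p q
  proof -
    have "p - 1 < CARD('n)" using that by simp
    thus ?thesis using that by (intro xi_entry_cong K assms(2)) auto
  qed
  thus ?thesis by (simp add: xi_diag_def pos_less_card)
qed

text \<open>The Boolean selects the factor of the CMV matrix, True for \<L> and False for \<M>; the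
  bound m allows for the partial products that arise when blocks are split off one by one.\<close>

definition parity_below :: "bool \<Rightarrow> nat \<Rightarrow> nat set" where
  "parity_below e m = {k. even k = e \<and> k < m}"

lemma cmv_L_eq: "cmv_L \<alpha> = (xi_diag (parity_below True CARD('n)) \<alpha> :: 'n::{finite,linorder} cmat)"
proof -
  have "cmv_L \<alpha> = (xi_diag {l. even l = True \<and> 0 \<le> l} \<alpha> :: 'n cmat)"
    using block_diag_Xi[of 0 _ _ "CARD('n)" True \<alpha>]
    by (auto simp: cmv_L_def xi_diag_def vec_eq_iff pos_less_card)
  also have "\<dots> = xi_diag (parity_below True CARD('n)) \<alpha>"
    by (rule xi_diag_cong) (auto simp: parity_below_def)
  finally show ?thesis .
qed

lemma cmv_M_eq: "cmv_M \<alpha> = (xi_diag (parity_below False CARD('n)) \<alpha> :: 'n::{finite,linorder} cmat)"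
proof -
  have "[0..<CARD('n)] = 0 # [1..<CARD('n)]" by (simp add: upt_conv_Cons)
  hence f: "filter odd [0..<CARD('n)] = filter (\<lambda>l. even l = False) [1..<CARD('n)]" by simp
  have "cmv_M \<alpha> = (xi_diag {l. even l = False \<and> 1 \<le> l} \<alpha> :: 'n cmat)"
  proof -
    have "block_diag ((1, \<lambda>r s. 1) # map (Xi CARD('n) \<alpha>) (filter odd [0..<CARD('n)])) p q =
        xi_entry {l. even l = False \<and> 1 \<le> l} \<alpha> p q" if "p < CARD('n)" "q < CARD('n)" for p q
    proof (cases "1 \<le> p \<and> 1 \<le> q")
      case True
      thus ?thesis using that block_diag_Xi[of 1 p q "CARD('n)" False \<alpha>] unfolding f
        by (simp add: Suc_le_eq)
    next
      case False
      thus ?thesis by (auto simp: xi_entry_def)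
    qed
    thus ?thesis
      by (auto simp: cmv_M_def xi_diag_def vec_eq_iff pos_less_card)
  qed
  also have "\<dots> = xi_diag (parity_below False CARD('n)) \<alpha>"
    by (rule xi_diag_cong) (auto simp: parity_below_def intro: Suc_leI odd_pos)
  finally show ?thesis .
qed

lemma mat_mult_unit_column:
  assumes "\<And>l. B $ l $ j = (if l = j then 1 else 0)"
  shows "(A ** B) $ i $ j = (A $ i $ j :: complex)"
  by (simp add: mat_mult_nth assms if_distrib cong: if_cong)

lemma mat_mult_fixed_column:
  assumes "\<And>l i. B $ l $ j \<noteq> 0 \<Longrightarrow> A $ i $ l = (if i = l then 1 else 0)"
  shows "(A ** B) $ i $ j = (B $ i $ j :: complex)"
proof -
  have "(A ** B) $ i $ j = (\<Sum>l\<in>UNIV. if i = l then B $ l $ j else 0)"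
    unfolding mat_mult_nth using assms by (intro sum.cong refl) force
  thus ?thesis by simp
qed

lemma xi_entry_unit:
  assumes "q \<notin> K" "q = 0 \<or> q - 1 \<notin> K"
  shows "xi_entry K \<alpha> p q = (if p = q then 1 else 0)"
    and "xi_entry K \<alpha> q p = (if p = q then 1 else 0)"
  using assms by (cases q; simp add: xi_entry_def; fastforce)+

lemma xi_entry_insert:
  assumes "k \<notin> K" "Suc k \<notin> K" "k = 0 \<or> k - 1 \<notin> K"
  shows "xi_entry (insert k K) \<alpha> p q =
    (if q \<in> {k, Suc k} then xi_entry {k} \<alpha> p q else xi_entry K \<alpha> p q)"
  using assms by (cases p; cases q; cases k; simp add: xi_entry_def; fastforce?)

lemma xi_diag_unit_column:
  assumes "pos j \<notin> K" "pos j = 0 \<or> pos j - 1 \<notin> K"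
  shows "xi_diag K \<alpha> $ i $ j = (if i = j then 1 else 0)"
    and "xi_diag K \<alpha> $ j $ i = (if i = j then 1 else 0)"
  using xi_entry_unit[OF assms] by (simp_all add: xi_diag_nth)

lemma xi_entry_support:
  assumes "xi_entry K \<alpha> p q \<noteq> 0"
  shows "p = q \<or> q = Suc p \<and> p \<in> K \<or> p = Suc q \<and> q \<in> K"
  using assms by (auto simp: xi_entry_def split: if_splits)

text \<open>Blocks on disjoint index pairs commute, since a column touched by one factor meets only
  unit columns of the other. Both orders are recorded because even blocks are attached on the right
  of the left factor, odd ones on the left of the right factor.\<close>

lemma xi_diag_insert:
  assumes "k \<notin> K" "Suc k \<notin> K" "k = 0 \<or> k - 1 \<notin> K"
  shows "xi_diag (insert k K) \<alpha> = xi_diag K \<alpha> ** (xi_diag {k} \<alpha> :: 'n::{finite,linorder} cmat)" (is ?t1)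
    and "xi_diag (insert k K) \<alpha> = xi_diag {k} \<alpha> ** (xi_diag K \<alpha> :: 'n cmat)" (is ?t2)
proof -
  have "(xi_diag K \<alpha> ** xi_diag {k} \<alpha>) $ i $ j = (xi_diag (insert k K) \<alpha>) $ i $ j \<and>
    (xi_diag {k} \<alpha> ** xi_diag K \<alpha>) $ i $ j = (xi_diag (insert k K) \<alpha>) $ i $ j" for i j :: 'n
  proof (cases "pos j \<in> {k, Suc k}")
    case True
    have "(xi_diag K \<alpha> ** xi_diag {k} \<alpha>) $ i $ j = xi_diag {k} \<alpha> $ i $ j"
    proof (rule mat_mult_fixed_column)
      fix l i assume "xi_diag {k} \<alpha> $ l $ j \<noteq> 0"
      with True have "pos l \<in> {k, Suc k}" by (auto simp: xi_diag_nth dest: xi_entry_support)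
      thus "xi_diag K \<alpha> $ i $ l = (if i = l then 1 else 0)"
        using assms by (intro xi_diag_unit_column) auto
    qed
    moreover have "(xi_diag {k} \<alpha> ** xi_diag K \<alpha>) $ i $ j = xi_diag {k} \<alpha> $ i $ j"
      using True assms by (intro mat_mult_unit_column xi_diag_unit_column) auto
    moreover have "xi_diag {k} \<alpha> $ i $ j = xi_diag (insert k K) \<alpha> $ i $ j"
      using True xi_entry_insert[OF assms] by (simp add: xi_diag_nth)
    ultimately show ?thesis by simp
  next
    case False
    have "(xi_diag {k} \<alpha> ** xi_diag K \<alpha>) $ i $ j = xi_diag K \<alpha> $ i $ j"
    proof (rule mat_mult_fixed_column)
      fix l i assume "xi_diag K \<alpha> $ l $ j \<noteq> 0"
      with False assms have "pos l \<notin> {k, Suc k}"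
        by (auto simp: xi_diag_nth dest: xi_entry_support)
      thus "xi_diag {k} \<alpha> $ i $ l = (if i = l then 1 else 0)"
        by (intro xi_diag_unit_column) auto
    qed
    moreover have "(xi_diag K \<alpha> ** xi_diag {k} \<alpha>) $ i $ j = xi_diag K \<alpha> $ i $ j"
      using False by (intro mat_mult_unit_column xi_diag_unit_column) auto
    moreover have "xi_diag K \<alpha> $ i $ j = xi_diag (insert k K) \<alpha> $ i $ j"
      using False xi_entry_insert[OF assms] by (simp add: xi_diag_nth)
    ultimately show ?thesis by simp
  qed
  thus ?t1 ?t2 by (simp_all add: vec_eq_iff)
qed

lemma xi_diag_empty [simp]: "xi_diag {} \<alpha> = mat 1"
  by (auto simp: xi_diag_def xi_entry_def mat_def vec_eq_iff)

section \<open>Unitarity of embedded blocks\<close>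

lemma rho_sq: "cmod a \<le> 1 \<Longrightarrow> (rho a)\<^sup>2 = 1 - (cmod a)\<^sup>2"
  by (simp add: rho_def abs_square_le_1)

lemma rho_pos: "cmod a < 1 \<Longrightarrow> 0 < rho a"
  by (simp add: rho_def abs_square_less_1)

lemma rho_zero: "cmod a = 1 \<Longrightarrow> rho a = 0"
  by (simp add: rho_def)

lemma cnj_mult_plus_rho:
  assumes "cmod a \<le> 1"
  shows "a * cnj a + of_real (rho a) * of_real (rho a) = 1"
    "cnj a * a + of_real (rho a) * of_real (rho a) = 1"
proof -
  have "a * cnj a + of_real (rho a) * of_real (rho a) = of_real ((cmod a)\<^sup>2 + (rho a)\<^sup>2)"
    by (simp add: complex_norm_square[symmetric] power2_eq_square)
  also have "\<dots> = 1" using rho_sq[OF assms] by simp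
  finally show "a * cnj a + of_real (rho a) * of_real (rho a) = 1" .
  thus "cnj a * a + of_real (rho a) * of_real (rho a) = 1" by (simp add: mult.commute)
qed

text \<open>At k = n - 1 the block is truncated to the single entry \<open>cnj (\<alpha> k)\<close>,
  which is unitary only for a coefficient of modulus 1. Below that the two-by-two block is unitary
  by the choice of \<open>rho\<close>.\<close>

lemma unitary_xi_diag_single:
  assumes "cmod (\<alpha> k) \<le> 1" "Suc k = CARD('n) \<Longrightarrow> cmod (\<alpha> k) = 1"
  shows "unitary (xi_diag {k} \<alpha> :: 'n::{finite,linorder} cmat)"
proof -
  let ?D = "xi_diag {k} \<alpha> :: 'n cmat"
  have "(adjoint_mat ?D ** ?D) $ i $ j = mat 1 $ i $ j" for i j
  proof (cases "pos j \<in> {k, Suc k}")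
    case False
    hence "(adjoint_mat ?D ** ?D) $ i $ j = adjoint_mat ?D $ i $ j"
      by (intro mat_mult_unit_column xi_diag_unit_column) auto
    moreover have "pos j = 0 \<or> pos j - 1 \<notin> {k}" using False by auto
    ultimately show ?thesis using False xi_diag_unit_column(2)[of j "{k}" \<alpha> i]
      by (auto simp: adjoint_mat_def mat_def)
  next
    case True
    define S where "S = {l :: 'n. pos l \<in> {k, Suc k}}"
    have "(adjoint_mat ?D ** ?D) $ i $ j = (\<Sum>l\<in>S. cnj (?D $ l $ i) * ?D $ l $ j)"
      unfolding mat_mult_nth using True
      by (intro sum.mono_neutral_cong_right) (auto simp: adjoint_mat_def S_def xi_diag_nth dest: xi_entry_support)
    also have "\<dots> = mat 1 $ i $ j"
    proof (cases "Suc k < CARD('n)")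
      case True
      then obtain e f :: 'n where ef: "pos e = k" "pos f = Suc k"
        by (metis pos_surj Suc_lessD)
      have eq: "l = e \<longleftrightarrow> pos l = k" "l = f \<longleftrightarrow> pos l = Suc k" for l
        using ef by (metis pos_eq_iff)+
      have S: "S = {e, f}" unfolding S_def using eq by blast
      have ne: "e \<noteq> f" using ef by force
      have D: "?D $ e $ e = cnj (\<alpha> k)" "?D $ f $ f = - \<alpha> k"
        "?D $ e $ f = of_real (rho (\<alpha> k))" "?D $ f $ e = of_real (rho (\<alpha> k))"
        by (simp_all add: xi_diag_nth xi_entry_def ef)
      have D0: "?D $ e $ i = 0 \<and> ?D $ f $ i = 0" if "i \<noteq> e" "i \<noteq> f"
        using that xi_entry_support[of "{k}" \<alpha> k "pos i"] xi_entry_support[of "{k}" \<alpha> "Suc k" "pos i"]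
        unfolding eq xi_diag_nth ef by auto
      have j: "j = e \<or> j = f" using \<open>pos j \<in> _\<close> unfolding eq by auto
      have "(\<Sum>l\<in>S. cnj (?D $ l $ i) * ?D $ l $ j) = cnj (?D $ e $ i) * ?D $ e $ j + cnj (?D $ f $ i) * ?D $ f $ j"
        using S ne by simp
      also have "\<dots> = mat 1 $ i $ j"
        using j D0 ne cnj_mult_plus_rho[OF assms(1)]
        by (cases "i = e"; cases "i = f") (auto simp: D mat_def add.commute)
      finally show ?thesis .
    next
      case False
      have p: "pos l \<noteq> Suc k" for l :: 'n using pos_less_card[of l] False by auto
      hence j: "pos j = k" using \<open>pos j \<in> _\<close> by auto
      hence "Suc k = CARD('n)" using pos_less_card[of j] False by auto
      hence "cmod (\<alpha> k) = 1" by (rule assms)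
      hence "\<alpha> k * cnj (\<alpha> k) = 1" by (simp add: complex_norm_square[symmetric])
      moreover have eq: "l = j \<longleftrightarrow> pos l = k" for l using j by (metis pos_eq_iff)
      have "S = {j}" unfolding S_def using eq p by blast
      moreover have "?D $ j $ j = cnj (\<alpha> k)" by (simp add: xi_diag_nth xi_entry_def j)
      moreover have "?D $ j $ i = 0" if "i \<noteq> j"
        using that p[of i] xi_entry_support[of "{k}" \<alpha> k "pos i"] unfolding eq xi_diag_nth j by auto
      ultimately show ?thesis by (cases "i = j") (auto simp: mat_def)
    qed
    finally show ?thesis .
  qed
  thus ?thesis by (simp add: unitary_def vec_eq_iff)
qed

lemma unitary_xi_diag:
  assumes "finite K" "\<And>k. k \<in> K \<Longrightarrow> Suc k \<notin> K" "\<And>k. k \<in> K \<Longrightarrow> cmod (\<alpha> k) \<le> 1"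
    "\<And>k. k \<in> K \<Longrightarrow> Suc k = CARD('n) \<Longrightarrow> cmod (\<alpha> k) = 1"
  shows "unitary (xi_diag K \<alpha> :: 'n::{finite,linorder} cmat)"
  using assms
proof (induction K)
  case (insert k K)
  have "xi_diag (insert k K) \<alpha> = xi_diag K \<alpha> ** (xi_diag {k} \<alpha> :: 'n cmat)"
  proof (rule xi_diag_insert)
    show "k = 0 \<or> k - 1 \<notin> K"
      using insert.prems(1)[of "k - 1"] by (cases k) auto
  qed (use insert in auto)
  thus ?case using insert by (auto intro!: unitary_mult unitary_xi_diag_single)
qed simp

section \<open>Partial products of the two factors\<close>

lemma finite_parity_below [simp]: "finite (parity_below e m)"
  by (simp add: parity_below_def)

lemma parity_below_sparse: "k \<in> parity_below e m \<Longrightarrow> Suc k \<notin> parity_below e m"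
  by (auto simp: parity_below_def)

lemma parity_below_Suc:
  "parity_below e (Suc m) = (if even m = e then insert m (parity_below e m) else parity_below e m)"
  by (auto simp: parity_below_def less_Suc_eq)

lemma xi_diag_parity_Suc:
  assumes "even m = e"
  shows "xi_diag (parity_below e (Suc m)) \<alpha> = xi_diag (parity_below e m) \<alpha> ** xi_diag {m} \<alpha>"
    "xi_diag (parity_below e (Suc m)) \<alpha> = xi_diag {m} \<alpha> ** xi_diag (parity_below e m) \<alpha>"
proof -
  have "m \<notin> parity_below e m" "Suc m \<notin> parity_below e m" "m = 0 \<or> m - 1 \<notin> parity_below e m"
    using assms by (cases m; auto simp: parity_below_def)+
  thus "xi_diag (parity_below e (Suc m)) \<alpha> = xi_diag (parity_below e m) \<alpha> ** xi_diag {m} \<alpha>"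
    "xi_diag (parity_below e (Suc m)) \<alpha> = xi_diag {m} \<alpha> ** xi_diag (parity_below e m) \<alpha>"
    using assms xi_diag_insert[of m "parity_below e m"] by (auto simp: parity_below_Suc)
qed

lemma cmv_eq: "cmv \<alpha> = xi_diag (parity_below True CARD('n)) \<alpha> **
    (xi_diag (parity_below False CARD('n)) \<alpha> :: 'n::{finite,linorder} cmat)"
  by (simp add: cmv_def cmv_L_eq cmv_M_eq)

lemma cmv_cong:
  assumes "\<And>k. k < CARD('n) \<Longrightarrow> \<alpha> k = \<beta> k"
  shows "cmv \<alpha> = (cmv \<beta> :: 'n::{finite,linorder} cmat)"
  unfolding cmv_eq using assms by (metis (no_types, lifting) xi_diag_cong)

lemma cmv_coeffs_le: "cmv_coeffs n \<alpha> \<Longrightarrow> k < n \<Longrightarrow> cmod (\<alpha> k) \<le> 1"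
  by (cases "k = n - 1") (auto simp: cmv_coeffs_def intro: less_imp_le)

lemma unitary_xi_diag_coeffs:
  assumes "cmv_coeffs CARD('n) \<alpha>" "K \<subseteq> parity_below e CARD('n)"
  shows "unitary (xi_diag K \<alpha> :: 'n::{finite,linorder} cmat)"
proof (rule unitary_xi_diag)
  show "finite K" using assms(2) by (rule finite_subset) simp
  show "Suc k \<notin> K" if "k \<in> K" for k
    using that assms(2) parity_below_sparse by blast
  show "cmod (\<alpha> k) \<le> 1" if "k \<in> K" for k
    using that assms by (auto simp: parity_below_def intro: cmv_coeffs_le)
  show "cmod (\<alpha> k) = 1" if "Suc k = CARD('n)" for k
    using assms(1) that[symmetric] by (simp add: cmv_coeffs_def)
qed

lemma unitary_cmv: "cmv_coeffs CARD('n) \<alpha> \<Longrightarrow> unitary (cmv \<alpha> :: 'n::{finite,linorder} cmat)"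
  unfolding cmv_eq by (intro unitary_mult unitary_xi_diag_coeffs) auto

section \<open>The shape of a CMV matrix\<close>

definition pos_real :: "complex \<Rightarrow> bool" where
  "pos_real z \<longleftrightarrow> Im z = 0 \<and> 0 < Re z"

lemma pos_real_of_real [simp]: "pos_real (of_real r) \<longleftrightarrow> 0 < r"
  by (simp add: pos_real_def)

lemma pos_real_mult_of_real: "0 < r \<Longrightarrow> pos_real (of_real r * z) \<longleftrightarrow> pos_real z"
  by (auto simp: pos_real_def zero_less_mult_iff)

lemma pos_realE:
  assumes "pos_real z" obtains r where "z = of_real r" "0 < r"
  using assms by (metis pos_real_def complex_is_Real_iff of_real_Re)

text \<open>The left factor links indices with the same value of i div 2, the right factor indices
  with the same value of (j + 1) div 2. Hence the rows 2m and 2m + 1 reach only the columns from 2m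
  - 1 to 2m + 2.\<close>

definition cmv_zeros :: "'n::{finite,linorder} cmat \<Rightarrow> bool" where
  "cmv_zeros A \<longleftrightarrow> (\<forall>i j. A $ i $ j \<noteq> 0 \<longrightarrow>
     (pos j + 1) div 2 = pos i div 2 \<or> (pos j + 1) div 2 = pos i div 2 + 1)"

text \<open>Indices of the extreme entries of the pattern; truncated subtraction puts corner \<open>0\<close> at
  \<open>(1, 0)\<close>.\<close>

definition corner :: "nat \<Rightarrow> 'n::{finite,linorder} \<Rightarrow> 'n \<Rightarrow> bool" where
  "corner k i j \<longleftrightarrow> (if even k then pos i = Suc k \<and> pos j = k - 1 else pos i = k - 1 \<and> pos j = Suc k)"

definition cmv_shape :: "'n::{finite,linorder} cmat \<Rightarrow> bool" where
  "cmv_shape A \<longleftrightarrow> cmv_zeros A \<and> (\<forall>k i j. corner k i j \<longrightarrow> pos_real (A $ i $ j))"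

lemma mat_mult_single:
  assumes "\<And>l. l \<noteq> m \<Longrightarrow> A $ i $ l = 0 \<or> B $ l $ j = 0"
  shows "(A ** B) $ i $ j = A $ i $ m * (B $ m $ j :: complex)"
proof -
  have "(A ** B) $ i $ j = (\<Sum>l\<in>UNIV. if l = m then A $ i $ m * B $ m $ j else 0)"
    unfolding mat_mult_nth using assms by (intro sum.cong refl) force
  thus ?thesis by simp
qed

lemma xi_entry_even_support:
  assumes "xi_entry (parity_below True n) \<alpha> p q \<noteq> 0"
  shows "p div 2 = q div 2"
  using xi_entry_support[OF assms] by (auto simp: parity_below_def elim!: evenE)

lemma xi_entry_odd_support:
  assumes "xi_entry (parity_below False n) \<alpha> p q \<noteq> 0"
  shows "(p + 1) div 2 = (q + 1) div 2"
  using xi_entry_support[OF assms] by (auto simp: parity_below_def elim!: oddE)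

lemma cmv_shape_cmv:
  assumes \<alpha>: "cmv_coeffs CARD('n) \<alpha>"
  shows "cmv_shape (cmv \<alpha> :: 'n::{finite,linorder} cmat)"
proof -
  let ?n = "CARD('n)"
  let ?L = "xi_diag (parity_below True ?n) \<alpha> :: 'n cmat"
  let ?M = "xi_diag (parity_below False ?n) \<alpha> :: 'n cmat"
  have L: "pos i div 2 = pos l div 2" if "?L $ i $ l \<noteq> 0" for i l
    using that xi_entry_even_support by (simp add: xi_diag_nth)
  have M: "(pos l + 1) div 2 = (pos j + 1) div 2" if "?M $ l $ j \<noteq> 0" for l j
    using that xi_entry_odd_support by (simp only: xi_diag_nth)
  have "cmv_zeros (?L ** ?M)"
    unfolding cmv_zeros_def
  proof (intro allI impI)
    fix i j assume "(?L ** ?M) $ i $ j \<noteq> 0"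
    then obtain l where "?L $ i $ l * ?M $ l $ j \<noteq> 0"
      unfolding mat_mult_nth by (rule sum.not_neutral_contains_not_neutral)
    hence "pos i div 2 = pos l div 2" "(pos l + 1) div 2 = (pos j + 1) div 2"
      using L M by auto
    thus "(pos j + 1) div 2 = pos i div 2 \<or> (pos j + 1) div 2 = pos i div 2 + 1"
      by linarith
  qed
  moreover have "pos_real ((?L ** ?M) $ i $ j)" if c: "corner k i j" for k i j
  proof -
    have k: "Suc k < ?n"
      using c pos_less_card[of i] pos_less_card[of j] by (auto simp: corner_def split: if_splits)
    then obtain m :: 'n where m: "pos m = k" by (metis pos_surj Suc_lessD)
    have r: "0 < rho (\<alpha> l)" if "l \<le> k" for l
      using \<alpha> that k by (intro rho_pos) (simp add: cmv_coeffs_def)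
    \<comment> \<open>Index k is the only intermediate index joining i to j, so a corner is one
      entry of the left factor times one of the right:
      \<open>rho (\<alpha> k) * rho (\<alpha> (k - 1))\<close>, or \<open>rho (\<alpha> 0)\<close>
      for k = 0.\<close>
    have e: "(?L ** ?M) $ i $ j = ?L $ i $ m * ?M $ m $ j"
    proof (rule mat_mult_single)
      fix l assume "l \<noteq> m"
      hence "pos l \<noteq> k" unfolding m[symmetric] by simp
      show "?L $ i $ l = 0 \<or> ?M $ l $ j = 0"
      proof (rule ccontr)
        assume "\<not> ?thesis"
        hence "pos i div 2 = pos l div 2" "(pos l + 1) div 2 = (pos j + 1) div 2"
          using L M by auto
        with c \<open>pos l \<noteq> k\<close> show False
          unfolding corner_def by (cases k) (auto split: if_splits elim!: evenE oddE; presburger)+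
      qed
    qed
    show ?thesis
    proof (cases k)
      case 0
      hence "(?L ** ?M) $ i $ j = of_real (rho (\<alpha> 0))"
        using c m k unfolding e xi_diag_nth by (auto simp: corner_def xi_entry_def parity_below_def)
      thus ?thesis using r[of 0] by simp
    next
      case (Suc l)
      have "(?L ** ?M) $ i $ j = of_real (rho (\<alpha> k) * rho (\<alpha> l))"
      proof (cases "even k")
        case True
        hence "pos i = Suc k" "pos j = l" using c Suc by (auto simp: corner_def)
        thus ?thesis using True Suc k unfolding e xi_diag_nth m
          by (simp add: xi_entry_def parity_below_def)
      next
        case False
        hence "pos i = l" "pos j = Suc k" using c Suc by (auto simp: corner_def)
        thus ?thesis using False Suc k unfolding e xi_diag_nth m
          by (simp add: xi_entry_def parity_below_def mult.commute)
      qed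
      thus ?thesis using r[of k] r[of l] Suc by (simp only: pos_real_of_real) simp
    qed
  qed
  ultimately show ?thesis unfolding cmv_eq cmv_shape_def by blast
qed

section \<open>Factorising a unitary matrix of CMV shape\<close>

definition identity_below :: "nat \<Rightarrow> 'n::{finite,linorder} cmat \<Rightarrow> bool" where
  "identity_below k W \<longleftrightarrow> (\<forall>i j. pos i < k \<or> pos j < k \<longrightarrow> W $ i $ j = (if i = j then 1 else 0))"

lemma mat_mult_unit_row:
  assumes "\<And>l. A $ i $ l = (if l = i then 1 else 0)"
  shows "(A ** B) $ i $ j = (B $ i $ j :: complex)"
  by (simp add: mat_mult_nth assms if_distrib[of "\<lambda>x. x * _"] cong: if_cong)

lemma transpose_nth: "transpose A $ i $ j = A $ j $ i"
  by (simp add: transpose_def)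

lemma xi_entry_commute: "xi_entry K \<alpha> p q = xi_entry K \<alpha> q p"
  by (cases "p = q") (auto simp: xi_entry_def)

lemma transpose_xi_diag: "transpose (xi_diag K \<alpha>) = xi_diag K \<alpha>"
  by (simp add: vec_eq_iff transpose_nth xi_diag_nth xi_entry_commute)

lemma unitary_transpose:
  assumes "unitary W"
  shows "unitary (transpose W)"
proof -
  have "adjoint_mat (transpose W) = transpose (adjoint_mat W)"
    by (simp add: vec_eq_iff transpose_nth adjoint_mat_def)
  thus ?thesis
    using unitaryD(2)[OF assms] unfolding unitary_def
    by (metis matrix_transpose_mul transpose_mat)
qed

lemma identity_below_transpose: "identity_below k (transpose W) \<longleftrightarrow> identity_below k W"
  by (auto simp: identity_below_def transpose_nth)

lemma unitary_column_norm:
  assumes "unitary W"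
  shows "(\<Sum>i\<in>UNIV. (cmod (W $ i $ j))\<^sup>2) = 1"
proof -
  have "(adjoint_mat W ** W) $ j $ j = (\<Sum>i\<in>UNIV. of_real ((cmod (W $ i $ j))\<^sup>2))"
    unfolding mat_mult_nth
    by (intro sum.cong refl) (simp add: adjoint_mat_def complex_norm_square mult.commute del: of_real_power)
  hence "complex_of_real (\<Sum>i\<in>UNIV. (cmod (W $ i $ j))\<^sup>2) = 1"
    using unitaryD(1)[OF assms] by (simp add: mat_def)
  thus ?thesis by (simp only: of_real_eq_1_iff)
qed

lemma unitary_row_of_unit_column:
  assumes "unitary W" "\<And>i. W $ i $ e = (if i = e then 1 else 0)"
  shows "W $ e $ j = (if e = j then 1 else 0)"
proof -
  have "(adjoint_mat W ** W) $ e $ j = W $ e $ j"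
    using assms(2) by (intro mat_mult_unit_row) (simp add: adjoint_mat_def)
  thus ?thesis using unitaryD(1)[OF assms(1)] by (simp add: mat_def)
qed

text \<open>A unit vector (cnj a, r) with r > 0 is the first column of the block with coefficient a,
  because the norm forces r = \<open>rho a\<close>. Multiplication by the adjoint block makes this
  column a unit vector of the standard basis, and unitarity does the same for the row. The last two
  conclusions hand the next corner and the zero pattern on to the remainder.\<close>

lemma peel_column:
  fixes W :: "'n::{finite,linorder} cmat"
  assumes W: "unitary W" and id: "identity_below k W" and e: "pos e = k" and f: "pos f = Suc k"
    and supp: "\<And>i. W $ i $ e \<noteq> 0 \<Longrightarrow> i = e \<or> i = f" and corner: "pos_real (W $ f $ e)"
  obtains a W' where "cmod a < 1" "W = xi_diag {k} (\<lambda>_. a) ** W'" "unitary W'"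
    "identity_below (Suc k) W'" "\<And>i j. i \<noteq> e \<Longrightarrow> i \<noteq> f \<Longrightarrow> W' $ i $ j = W $ i $ j"
    "\<And>j. j \<noteq> e \<Longrightarrow> W $ e $ j = of_real (rho a) * W' $ f $ j"
    "\<And>j i. W $ e $ j = 0 \<Longrightarrow> W $ f $ j = 0 \<Longrightarrow> i = e \<or> i = f \<Longrightarrow> W' $ i $ j = 0"
proof -
  define a where "a = cnj (W $ e $ e)"
  let ?D = "xi_diag {k} (\<lambda>_. a) :: 'n cmat"
  define W' where "W' = adjoint_mat ?D ** W"
  have n: "Suc k < CARD('n)" using f pos_less_card[of f] by simp
  have ne: "e \<noteq> f" using e f by force
  have eq: "l = e \<longleftrightarrow> pos l = k" "l = f \<longleftrightarrow> pos l = Suc k" for l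
    using e f by (metis pos_eq_iff)+
  have D: "?D $ e $ e = cnj a" "?D $ f $ f = - a"
      "?D $ e $ f = of_real (rho a)" "?D $ f $ e = of_real (rho a)"
    by (simp_all add: xi_diag_nth xi_entry_def e f)
  have D0: "?D $ i $ j = (if i = j then 1 else 0)" "?D $ j $ i = (if i = j then 1 else 0)"
    if "j \<noteq> e" "j \<noteq> f" for i j
  proof -
    have "pos j \<notin> {k}" "pos j = 0 \<or> pos j - 1 \<notin> {k}" using that unfolding eq by auto
    thus "?D $ i $ j = (if i = j then 1 else 0)" "?D $ j $ i = (if i = j then 1 else 0)"
      by (rule xi_diag_unit_column)+
  qed
  obtain r where r: "W $ f $ e = of_real r" "0 < r" using corner by (rule pos_realE)
  have "(\<Sum>i\<in>UNIV. (cmod (W $ i $ e))\<^sup>2) = (\<Sum>i\<in>{e, f}. (cmod (W $ i $ e))\<^sup>2)"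
    by (rule sum.mono_neutral_right) (use supp in auto)
  hence nrm: "(cmod a)\<^sup>2 + r\<^sup>2 = 1"
    using unitary_column_norm[OF W, of e] ne r by (simp add: a_def)
  hence "(cmod a)\<^sup>2 < 1" using r(2) by (smt (verit) zero_less_power)
  hence a1: "cmod a < 1" by (simp add: abs_square_less_1)
  have rho: "rho a = r"
    unfolding rho_def using nrm r(2) by (intro real_sqrt_unique) auto
  have uD: "unitary ?D"
    using a1 n by (intro unitary_xi_diag_single) auto
  have WD: "W = ?D ** W'"
    unfolding W'_def using unitaryD(2)[OF uD] by (simp add: matrix_mul_assoc)
  have uW': "unitary W'"
    unfolding W'_def using uD W by (intro unitary_mult) auto
  have rows: "W' $ i $ j = W $ i $ j" if "i \<noteq> e" "i \<noteq> f" for i j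
    unfolding W'_def using D0[OF that] by (intro mat_mult_unit_row) (simp add: adjoint_mat_def)
  have col: "W' $ i $ e = (if i = e then 1 else 0)" for i
  proof -
    have "W $ l $ e = ?D $ l $ e" for l
      using supp[of l] r rho D D0[of l e] by (cases "l = e"; cases "l = f") (auto simp: a_def)
    hence "W' $ i $ e = (adjoint_mat ?D ** ?D) $ i $ e"
      unfolding W'_def mat_mult_nth by simp
    thus ?thesis using unitaryD(1)[OF uD] by (simp add: mat_def)
  qed
  have row: "W' $ e $ j = (if e = j then 1 else 0)" for j
    using uW' col by (rule unitary_row_of_unit_column)
  have cols: "W' $ i $ j = (if i = j then 1 else 0)" if "pos j < k" for i j
  proof -
    have "W' $ i $ j = adjoint_mat ?D $ i $ j"
      unfolding W'_def using id that by (intro mat_mult_unit_column) (simp add: identity_below_def)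
    moreover have "j \<noteq> e" "j \<noteq> f" using that unfolding eq by auto
    ultimately show ?thesis using D0[of j i] by (simp add: adjoint_mat_def)
  qed
  show ?thesis
  proof (rule that[OF a1 WD uW' _ rows])
    show "identity_below (Suc k) W'"
      unfolding identity_below_def
    proof (intro allI impI)
      fix i j :: 'n assume "pos i < Suc k \<or> pos j < Suc k"
      then consider "pos j < k" | "pos i < k" | "i = e" | "j = e"
        unfolding eq by force
      thus "W' $ i $ j = (if i = j then 1 else 0)"
      proof cases
        case 2
        hence "i \<noteq> e" "i \<noteq> f" unfolding eq by auto
        thus ?thesis using rows id 2 by (simp add: identity_below_def)
      qed (use col row cols in auto)
    qed
    show "W $ e $ j = of_real (rho a) * W' $ f $ j" if "j \<noteq> e" for j
    proof -
      have "W $ e $ j = (\<Sum>l\<in>UNIV. ?D $ e $ l * W' $ l $ j)"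
        by (subst WD) (rule mat_mult_nth)
      also have "\<dots> = (\<Sum>l\<in>{e, f}. ?D $ e $ l * W' $ l $ j)"
        by (rule sum.mono_neutral_right) (use D0(1)[of _ e] in auto)
      also have "\<dots> = of_real (rho a) * W' $ f $ j"
        using ne that by (simp add: D row)
      finally show ?thesis .
    qed
    show "W' $ i $ j = 0" if "W $ e $ j = 0" "W $ f $ j = 0" "i = e \<or> i = f" for i j
    proof -
      have "adjoint_mat ?D $ i $ l * W $ l $ j = 0" for l
        using that D0(2)[of l i] by (cases "l = e"; cases "l = f") (auto simp: adjoint_mat_def)
      thus ?thesis unfolding W'_def mat_mult_nth by (intro sum.neutral) blast
    qed
  qed
qed

lemma parity_below_Suc_other: "even m \<noteq> e \<Longrightarrow> parity_below e (Suc m) = parity_below e m"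
  by (simp add: parity_below_Suc)

lemma xi_diag_absorb:
  "even k \<Longrightarrow> xi_diag (parity_below True k) \<alpha> ** (xi_diag {k} \<alpha> ** W) ** xi_diag (parity_below False k) \<alpha> =
    xi_diag (parity_below True (Suc k)) \<alpha> ** W ** xi_diag (parity_below False (Suc k)) \<alpha>"
  "odd k \<Longrightarrow> xi_diag (parity_below True k) \<alpha> ** (W ** xi_diag {k} \<alpha>) ** xi_diag (parity_below False k) \<alpha> =
    xi_diag (parity_below True (Suc k)) \<alpha> ** W ** xi_diag (parity_below False (Suc k)) \<alpha>"
  by (simp_all add: xi_diag_parity_Suc(1)[of k True] xi_diag_parity_Suc(2)[of k False]
      parity_below_Suc_other matrix_mul_assoc)

text \<open>Blocks leave in the order 0, 1, 2, ..., even ones to the left and odd ones to the right;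
  \<open>inv\<close> keeps the remainder W between the two partial products. After n - 1 steps W
  differs from the identity at most in its last diagonal entry, and unitarity makes that entry
  unimodular.\<close>

lemma cmv_matrices_of_shape:
  fixes A :: "'n::{finite,linorder} cmat"
  assumes A: "unitary A" "cmv_shape A"
  shows "A \<in> cmv_matrices"
proof -
  let ?n = "CARD('n)"
  let ?D = "\<lambda>e k \<alpha>. xi_diag (parity_below e k) \<alpha> :: 'n cmat"
  \<comment> \<open>Removing block k - 1 moves corner k one step towards the diagonal, up to a
    positive factor: to (k + 1, k) for even k and to (k, k + 1) for odd k. Corner 0 sits in that
    place from the start.\<close>
  define first where "first k W \<longleftrightarrow> (\<forall>e f. pos e = k \<longrightarrow> pos f = Suc k \<longrightarrow>
      pos_real (if even k then W $ f $ e else W $ e $ f))" for k and W :: "'n cmat"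
  define inv where "inv k \<alpha> W \<longleftrightarrow> (\<forall>j<k. cmod (\<alpha> j) < 1) \<and> A = ?D True k \<alpha> ** W ** ?D False k \<alpha>
      \<and> unitary W \<and> identity_below k W \<and> cmv_zeros W \<and> first k W
      \<and> (\<forall>l i j. k < l \<longrightarrow> corner l i j \<longrightarrow> pos_real (W $ i $ j))" for k \<alpha> W
  have absorb: "\<exists>\<alpha>'. (\<forall>j<k. \<alpha>' j = \<alpha> j) \<and> \<alpha>' k = a \<and>
      A = ?D True (Suc k) \<alpha>' ** W' ** ?D False (Suc k) \<alpha>'"
    if "A = ?D True k \<alpha> ** W ** ?D False k \<alpha>"
      "W = (if even k then xi_diag {k} (\<lambda>_. a) ** W' else W' ** xi_diag {k} (\<lambda>_. a))" for k \<alpha> W W' a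
  proof -
    define \<alpha>' where "\<alpha>' = \<alpha>(k := a)"
    have "?D e k \<alpha> = ?D e k \<alpha>'" for e
      by (rule xi_diag_cong) (auto simp: \<alpha>'_def parity_below_def)
    moreover have "xi_diag {k} (\<lambda>_. a) = (xi_diag {k} \<alpha>' :: 'n cmat)"
      by (rule xi_diag_cong) (auto simp: \<alpha>'_def)
    ultimately have "A = ?D True (Suc k) \<alpha>' ** W' ** ?D False (Suc k) \<alpha>'"
      using that xi_diag_absorb[of k \<alpha>' W'] by (simp split: if_splits)
    thus ?thesis by (intro exI[of _ \<alpha>']) (auto simp: \<alpha>'_def)
  qed
  have step: "\<exists>\<alpha> W. inv (Suc k) \<alpha> W" if inv: "inv k \<alpha> W" and k: "Suc k < ?n" for k \<alpha> W
  proof -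
    obtain e f :: 'n where e: "pos e = k" and f: "pos f = Suc k"
      using k by (metis pos_surj Suc_lessD)
    have eq: "l = e \<longleftrightarrow> pos l = k" "l = f \<longleftrightarrow> pos l = Suc k" for l
      using e f by (metis pos_eq_iff)+
    have W: "unitary W" "identity_below k W" "cmv_zeros W" "first k W"
      and corner: "\<And>l i j. k < l \<Longrightarrow> corner l i j \<Longrightarrow> pos_real (W $ i $ j)"
      and \<alpha>: "\<forall>j<k. cmod (\<alpha> j) < 1" and AW: "A = ?D True k \<alpha> ** W ** ?D False k \<alpha>"
      using inv by (auto simp: inv_def)
    have below: "W $ i $ j = 0" if "i \<noteq> j" "pos i < k \<or> pos j < k" for i j
      using W(2) that by (auto simp: identity_below_def)
    have zeros: "(pos j + 1) div 2 = pos i div 2 \<or> (pos j + 1) div 2 = pos i div 2 + 1"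
      if "W $ i $ j \<noteq> 0" for i j
      using W(3) that by (simp add: cmv_zeros_def)
    have "\<exists>a W'. cmod a < 1 \<and> W = (if even k then xi_diag {k} (\<lambda>_. a) ** W' else W' ** xi_diag {k} (\<lambda>_. a))
      \<and> unitary W' \<and> identity_below (Suc k) W' \<and> cmv_zeros W' \<and> first (Suc k) W'
      \<and> (\<forall>l i j. Suc k < l \<longrightarrow> corner l i j \<longrightarrow> pos_real (W' $ i $ j))"
    proof (cases "even k")
      case True
      have supp: "i = e \<or> i = f" if "W $ i $ e \<noteq> 0" for i
        using zeros[OF that] below[of i e] that e True unfolding eq
        by (cases "pos i < k") (auto elim!: evenE)
      have c: "pos_real (W $ f $ e)" using W(4) e f True by (simp add: first_def)
      obtain a W' where a: "cmod a < 1" and WW: "W = xi_diag {k} (\<lambda>_. a) ** W'" and u: "unitary W'"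
        and id: "identity_below (Suc k) W'"
        and rest: "\<And>i j. i \<noteq> e \<Longrightarrow> i \<noteq> f \<Longrightarrow> W' $ i $ j = W $ i $ j"
        and nxt: "\<And>j. j \<noteq> e \<Longrightarrow> W $ e $ j = of_real (rho a) * W' $ f $ j"
        and zer: "\<And>j i. W $ e $ j = 0 \<Longrightarrow> W $ f $ j = 0 \<Longrightarrow> i = e \<or> i = f \<Longrightarrow> W' $ i $ j = 0"
        using peel_column[OF W(1,2) e f supp c] by metis
      have "cmv_zeros W'"
        unfolding cmv_zeros_def
      proof (intro allI impI)
        fix i j assume nz: "W' $ i $ j \<noteq> 0"
        \<comment> \<open>For even k the rows k and k + 1 have the same admissible columns, so
          mixing these two rows respects the zero pattern.\<close>
        have div: "pos e div 2 = k div 2" "pos f div 2 = k div 2" using e f True by auto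
        show "(pos j + 1) div 2 = pos i div 2 \<or> (pos j + 1) div 2 = pos i div 2 + 1"
          using nz zer[of j i] zeros[of e j] zeros[of f j] zeros[of i j] rest[of i j] div by metis
      qed
      moreover have "first (Suc k) W'"
      proof -
        have "pos_real (W' $ f $ g)" if "pos g = Suc (Suc k)" for g
        proof -
          have "g \<noteq> e" using that e by auto
          moreover have "pos_real (W $ e $ g)"
            using that e True by (intro corner[of "Suc k"]) (auto simp: corner_def)
          ultimately show ?thesis using nxt a by (simp add: pos_real_mult_of_real rho_pos)
        qed
        moreover have "i = f" if "pos i = Suc k" for i using that by (simp add: eq)
        ultimately show ?thesis using True by (auto simp: first_def)
      qed
      moreover have "pos_real (W' $ i $ j)" if "Suc k < l" "corner l i j" for l i j
      proof -
        \<comment> \<open>The corners beyond k + 1 lie in rows beyond k + 1, which the removal of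
          the block leaves unchanged.\<close>
        have "i \<noteq> e \<and> i \<noteq> f"
          using that True unfolding eq corner_def by (auto split: if_splits; presburger)
        thus ?thesis using rest corner[of l i j] that by simp
      qed
      ultimately show ?thesis using a WW u id True by (intro exI[of _ a] exI[of _ W']) auto
    next
      case False
      \<comment> \<open>The blocks are symmetric, so transposition turns a factor on the right into
        one on the left, and the column case applies to odd k as well.\<close>
      let ?V = "transpose W"
      have supp: "i = e \<or> i = f" if "?V $ i $ e \<noteq> 0" for i
        using zeros[of e i] below[of e i] that e False unfolding eq
        by (cases "pos i < k") (auto elim!: oddE simp: transpose_nth)
      have c: "pos_real (?V $ f $ e)" using W(4) e f False by (simp add: first_def transpose_nth)
      obtain a V' where a: "cmod a < 1" and WW: "?V = xi_diag {k} (\<lambda>_. a) ** V'" and u: "unitary V'"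
        and id: "identity_below (Suc k) V'"
        and rest: "\<And>i j. i \<noteq> e \<Longrightarrow> i \<noteq> f \<Longrightarrow> V' $ i $ j = ?V $ i $ j"
        and nxt: "\<And>j. j \<noteq> e \<Longrightarrow> ?V $ e $ j = of_real (rho a) * V' $ f $ j"
        and zer: "\<And>j i. ?V $ e $ j = 0 \<Longrightarrow> ?V $ f $ j = 0 \<Longrightarrow> i = e \<or> i = f \<Longrightarrow> V' $ i $ j = 0"
        using peel_column[OF unitary_transpose[OF W(1)] _ e f supp c] W(2)
        by (metis identity_below_transpose)
      let ?W' = "transpose V'"
      have WW': "W = ?W' ** xi_diag {k} (\<lambda>_. a)"
        using arg_cong[OF WW, of transpose] by (simp add: matrix_transpose_mul transpose_xi_diag)
      have "cmv_zeros ?W'"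
        unfolding cmv_zeros_def
      proof (intro allI impI)
        fix i j assume nz: "?W' $ i $ j \<noteq> 0"
        have div: "(pos e + 1) div 2 = (k + 1) div 2" "(pos f + 1) div 2 = (k + 1) div 2"
          using e f False by auto
        show "(pos j + 1) div 2 = pos i div 2 \<or> (pos j + 1) div 2 = pos i div 2 + 1"
          using nz zer[of i j] zeros[of i e] zeros[of i f] zeros[of i j] rest[of j i] div
          unfolding transpose_nth by metis
      qed
      moreover have "first (Suc k) ?W'"
      proof -
        have "pos_real (V' $ f $ g)" if "pos g = Suc (Suc k)" for g
        proof -
          have "g \<noteq> e" using that e by auto
          moreover have "pos_real (?V $ e $ g)"
            using that e False unfolding transpose_nth
            by (intro corner[of "Suc k"]) (auto simp: corner_def)
          ultimately show ?thesis using nxt a by (simp add: pos_real_mult_of_real rho_pos)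
        qed
        moreover have "i = f" if "pos i = Suc k" for i using that by (simp add: eq)
        ultimately show ?thesis using False by (auto simp: first_def transpose_nth)
      qed
      moreover have "pos_real (?W' $ i $ j)" if "Suc k < l" "corner l i j" for l i j
      proof -
        have "j \<noteq> e \<and> j \<noteq> f"
          using that False unfolding eq corner_def by (auto split: if_splits; presburger)
        thus ?thesis using rest[of j i] corner[of l i j] that by (simp add: transpose_nth)
      qed
      ultimately show ?thesis
        using a WW' unitary_transpose[OF u] id False
        by (intro exI[of _ a] exI[of _ ?W']) (auto simp: identity_below_transpose)
    qed
    then obtain a W' where a: "cmod a < 1"
      and WW: "W = (if even k then xi_diag {k} (\<lambda>_. a) ** W' else W' ** xi_diag {k} (\<lambda>_. a))"
      and W': "unitary W'" "identity_below (Suc k) W'" "cmv_zeros W'" "first (Suc k) W'"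
        "\<forall>l i j. Suc k < l \<longrightarrow> corner l i j \<longrightarrow> pos_real (W' $ i $ j)"
      by blast
    obtain \<alpha>' where \<alpha>': "\<forall>j<k. \<alpha>' j = \<alpha> j" "\<alpha>' k = a"
      "A = ?D True (Suc k) \<alpha>' ** W' ** ?D False (Suc k) \<alpha>'"
      using absorb[OF AW WW] by blast
    have "inv (Suc k) \<alpha>' W'"
      using \<alpha> \<alpha>' a W' by (auto simp: inv_def less_Suc_eq)
    thus ?thesis by blast
  qed
  have ex: "\<exists>\<alpha> W. inv k \<alpha> W" if "k < ?n" for k
    using that
  proof (induction k)
    case 0
    have "first 0 A"
      unfolding first_def
    proof (intro allI impI)
      fix e f :: 'n assume "pos e = 0" "pos f = Suc 0"
      hence "corner 0 f e" by (simp add: corner_def)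
      thus "pos_real (if even 0 then A $ f $ e else A $ e $ f)"
        using A by (auto simp: cmv_shape_def)
    qed
    hence "inv 0 (\<lambda>_. 0) A"
      using A by (auto simp: inv_def parity_below_def identity_below_def cmv_shape_def)
    thus ?case by blast
  next
    case (Suc k)
    thus ?case using step by (meson Suc_lessD)
  qed
  define k where "k = ?n - 1"
  have kn: "Suc k = ?n" by (simp add: k_def)
  then obtain \<alpha> W where "inv k \<alpha> W" using ex[of k] by auto
  hence W: "unitary W" "identity_below k W" and \<alpha>: "\<forall>j<k. cmod (\<alpha> j) < 1"
    and AW: "A = ?D True k \<alpha> ** W ** ?D False k \<alpha>"
    by (auto simp: inv_def)
  obtain e :: 'n where e: "pos e = k" using kn by (metis lessI pos_surj)
  define a where "a = cnj (W $ e $ e)"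
  have lt: "i = e \<or> pos i < k" for i
    using pos_less_card[of i] kn e by (metis less_Suc_eq pos_eq_iff)
  have W0: "W $ i $ j = (if i = j then if i = e then cnj a else 1 else 0)" for i j
    using lt[of i] lt[of j] W(2) by (auto simp: identity_below_def a_def)
  have "(\<Sum>i\<in>UNIV. (cmod (W $ i $ e))\<^sup>2) = (\<Sum>i\<in>UNIV. if i = e then (cmod a)\<^sup>2 else 0)"
    by (intro sum.cong) (auto simp: W0)
  hence a1: "cmod a = 1"
    using unitary_column_norm[OF W(1), of e] by (simp add: abs_square_eq_1)
  have "W = xi_diag {k} (\<lambda>_. a)"
  proof -
    have "W $ i $ j = xi_diag {k} (\<lambda>_. a) $ i $ j" for i j
    proof -
      have le: "pos l \<le> k" and eq: "l = e \<longleftrightarrow> pos l = k" for l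
        using lt[of l] e by (auto simp: less_imp_le)
      have "xi_entry {k} (\<lambda>_. a) p q = (if p = q then if p = k then cnj a else 1 else 0)"
        if "p \<le> k" "q \<le> k" for p q
        using that rho_zero[OF a1] by (auto simp: xi_entry_def)
      hence "xi_diag {k} (\<lambda>_. a) $ i $ j = (if pos i = pos j then if pos i = k then cnj a else 1 else 0)"
        using le by (simp add: xi_diag_nth)
      thus ?thesis unfolding W0 eq pos_eq_iff by simp
    qed
    thus ?thesis by (simp add: vec_eq_iff)
  qed
  \<comment> \<open>The remainder is itself the last block, so the rule used for the earlier blocks
    absorbs it with remainder 1.\<close>
  hence "W = (if even k then xi_diag {k} (\<lambda>_. a) ** mat 1 else mat 1 ** xi_diag {k} (\<lambda>_. a))"
    by simp
  from absorb[OF AW this] obtain \<alpha>' where \<alpha>': "\<forall>j<k. \<alpha>' j = \<alpha> j" "\<alpha>' k = a"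
    "A = ?D True ?n \<alpha>' ** mat 1 ** ?D False ?n \<alpha>'"
    unfolding kn by blast
  hence "A = cmv \<alpha>'" by (simp add: cmv_eq)
  moreover have "cmv_coeffs ?n \<alpha>'"
    using \<alpha> \<alpha>' a1 unfolding cmv_coeffs_def k_def[symmetric] by simp
  ultimately show ?thesis by (auto simp: cmv_matrices_def)
qed

section \<open>Invariants of Hamiltonian flows\<close>

lemma inner_eq_trace: "inner X Y = Re (trace (adjoint_mat X ** (Y :: 'n::finite cmat)))"
proof -
  have "trace (adjoint_mat X ** Y) = (\<Sum>i\<in>UNIV. \<Sum>j\<in>UNIV. cnj (X $ j $ i) * Y $ j $ i)"
    by (simp add: trace_mult_sum adjoint_mat_def)
  also have "\<dots> = (\<Sum>j\<in>UNIV. \<Sum>i\<in>UNIV. cnj (X $ j $ i) * Y $ j $ i)"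
    by (rule sum.swap)
  finally show ?thesis by (simp add: inner_vec_def inner_complex_def)
qed

text \<open>The defect H of unitarity satisfies the Lax equation H' = HA - AH, the terms with C
  cancelling. As H is self-adjoint, its squared norm has as derivative twice the real part of the
  trace of H(HA - AH), which is 0 by cyclicity.\<close>

lemma unitary_invariant:
  fixes \<gamma> :: "real \<Rightarrow> 'n::finite cmat"
  assumes der: "\<And>t. t \<in> {0..T} \<Longrightarrow>
      (\<gamma> has_vector_derivative \<gamma> t ** A t - C t ** \<gamma> t) (at t within {0..T})"
    and A: "\<And>t. adjoint_mat (A t) = - A t" and C: "\<And>t. adjoint_mat (C t) = - C t"
    and u: "unitary (\<gamma> 0)" and t: "t \<in> {0..T}"
  shows "unitary (\<gamma> t)"
proof -
  define H where "H t = adjoint_mat (\<gamma> t) ** \<gamma> t - mat 1" for t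
  have dH: "(H has_vector_derivative H s ** A s - A s ** H s) (at s within {0..T})" if "s \<in> {0..T}" for s
  proof -
    have d1: "((\<lambda>s. adjoint_mat (\<gamma> s)) has_vector_derivative
        adjoint_mat (\<gamma> s ** A s - C s ** \<gamma> s)) (at s within {0..T})"
      by (rule bounded_linear.has_vector_derivative[OF bounded_linear_adjoint_mat der[OF that]])
    have "((\<lambda>s. adjoint_mat (\<gamma> s) ** \<gamma> s - mat 1) has_vector_derivative
        (adjoint_mat (\<gamma> s) ** (\<gamma> s ** A s - C s ** \<gamma> s) + adjoint_mat (\<gamma> s ** A s - C s ** \<gamma> s) ** \<gamma> s) - 0)
        (at s within {0..T})"
      by (intro has_vector_derivative_diff has_vector_derivative_mat_mult d1 der that
          has_vector_derivative_const)
    moreover have "(adjoint_mat (\<gamma> s) ** (\<gamma> s ** A s - C s ** \<gamma> s)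
        + adjoint_mat (\<gamma> s ** A s - C s ** \<gamma> s) ** \<gamma> s) - 0 = H s ** A s - A s ** H s"
      by (simp add: H_def adjoint_mat_diff adjoint_mat_mult A C mat_mult_diff mat_diff_mult
          mat_mult_uminus mat_uminus_mult matrix_mul_assoc)
    ultimately show ?thesis unfolding H_def by simp
  qed
  have "((\<lambda>s. inner (H s) (H s)) has_vector_derivative 0) (at s within {0..T})" if "s \<in> {0..T}" for s
  proof -
    have adj: "adjoint_mat (H s) = H s"
      by (simp add: H_def adjoint_mat_diff adjoint_mat_mult)
    have "inner (H s) (H s ** A s - A s ** H s) = 0"
      unfolding inner_eq_trace adj mat_mult_diff trace_sub
      using trace_mul_sym[of "H s ** A s" "H s"] by (simp add: matrix_mul_assoc)
    thus ?thesis
      using bounded_bilinear.has_vector_derivative[OF bounded_bilinear_inner dH[OF that] dH[OF that]]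
      by (simp add: inner_commute)
  qed
  then obtain c where c: "\<And>s. s \<in> {0..T} \<Longrightarrow> inner (H s) (H s) = c"
    using has_vector_derivative_zero_constant[of "{0..T}" "\<lambda>s. inner (H s) (H s)"] by auto
  have "H 0 = 0" using u by (simp add: H_def unitary_def)
  hence "inner (H t) (H t) = 0" using c[of 0] c[of t] t by simp
  thus ?thesis by (simp add: H_def unitary_def)
qed

lemma has_vector_derivative_nth:
  assumes "(X has_vector_derivative V) F"
  shows "((\<lambda>t. X t $ i $ j) has_vector_derivative V $ i $ j) F"
  using bounded_linear.has_vector_derivative[OF bounded_linear_compose[OF bounded_linear_vec_nth bounded_linear_vec_nth] assms]
  by simp

section \<open>Derivative of the determinant\<close>

lemma permutation_fixing_all_but_one:
  assumes "p permutes UNIV" "\<And>j. j \<noteq> i \<Longrightarrow> p j = j"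
  shows "p = id"
proof -
  have "p i = i"
    using assms by (metis permutes_inj inj_eq)
  thus ?thesis using assms(2) by (metis eq_id_iff)
qed

text \<open>A permutation other than the identity moves at least two indices, so after one factor of
  its Leibniz term is differentiated another off-diagonal zero remains. The identity permutation
  alone contributes, and it yields the trace.\<close>

lemma det_has_vector_derivative_at_one:
  fixes X :: "real \<Rightarrow> 'n::finite cmat"
  assumes d: "(X has_vector_derivative V) (at t within S)" and X: "X t = mat 1"
  shows "((\<lambda>s. det (X s)) has_vector_derivative trace V) (at t within S)"
proof -
  let ?P = "{p. p permutes (UNIV :: 'n set)}"
  let ?D = "\<lambda>p. \<Sum>i\<in>UNIV. V $ i $ p i * (\<Prod>j\<in>UNIV - {i}. X t $ j $ p j)"
  have e: "((\<lambda>s. X s $ i $ j) has_derivative (\<lambda>h. h *\<^sub>R V $ i $ j)) (at t within S)" for i j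
    using has_vector_derivative_nth[OF d] by (simp add: has_vector_derivative_def)
  have "((\<lambda>s. \<Prod>i\<in>UNIV. X s $ i $ p i) has_vector_derivative ?D p) (at t within S)" for p
    using has_derivative_prod[of UNIV "\<lambda>i s. X s $ i $ p i" "\<lambda>i h. h *\<^sub>R V $ i $ p i", OF e]
    by (simp add: has_vector_derivative_def scaleR_sum_right)
  hence "((\<lambda>s. of_int (sign p) * (\<Prod>i\<in>UNIV. X s $ i $ p i)) has_vector_derivative of_int (sign p) * ?D p)
      (at t within S)" for p
    by (rule has_vector_derivative_mult_right)
  hence "((\<lambda>s. det (X s)) has_vector_derivative (\<Sum>p\<in>?P. of_int (sign p) * ?D p)) (at t within S)"
    unfolding det_def by (intro has_vector_derivative_sum) auto
  moreover have "of_int (sign p) * ?D p = (if p = id then trace V else 0)" if "p \<in> ?P" for p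
  proof (cases "p = id")
    case True
    thus ?thesis by (simp add: X mat_def trace_def)
  next
    case False
    have "(\<Prod>j\<in>UNIV - {i}. X t $ j $ p j) = 0" for i
    proof -
      obtain j where "j \<noteq> i" "p j \<noteq> j"
        using permutation_fixing_all_but_one[of p i] False \<open>p \<in> ?P\<close> by auto
      hence "X t $ j $ p j = 0" "j \<in> UNIV - {i}" by (auto simp: X mat_def)
      thus ?thesis by (intro prod_zero) auto
    qed
    hence "?D p = 0" by (simp only: mult_zero_right sum.neutral_const)
    thus ?thesis using False by simp
  qed
  hence "(\<Sum>p\<in>?P. of_int (sign p) * ?D p) = (\<Sum>p\<in>?P. if p = id then trace V else 0)"
    by (rule sum.cong[OF refl])
  also have "\<dots> = trace V" by (simp add: permutes_id)
  ultimately show ?thesis by simp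
qed

text \<open>Jacobi's formula, reduced to the identity matrix by translating with the inverse
  P.\<close>

lemma det_has_vector_derivative:
  fixes X :: "real \<Rightarrow> 'n::finite cmat"
  assumes d: "(X has_vector_derivative V) (at t within S)" and P: "P ** X t = mat 1"
  shows "((\<lambda>s. det (X s)) has_vector_derivative det (X t) * trace (P ** V)) (at t within S)"
proof -
  have P': "X t ** P = mat 1" using P by (simp add: matrix_left_right_inverse)
  have "((\<lambda>s. P ** X s) has_vector_derivative P ** V) (at t within S)"
    using bounded_bilinear.bounded_linear_right[OF bounded_bilinear_mat_mult] d
    by (rule bounded_linear.has_vector_derivative)
  hence "((\<lambda>s. det (P ** X s)) has_vector_derivative trace (P ** V)) (at t within S)"
    using P by (rule det_has_vector_derivative_at_one)
  hence "((\<lambda>s. det (X t) * det (P ** X s)) has_vector_derivative det (X t) * trace (P ** V)) (at t within S)"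
    by (rule has_vector_derivative_mult_right)
  moreover have "det (X t) * det (P ** X s) = det (X s)" for s
    using arg_cong[OF P', of det] by (simp add: det_mul mult.assoc[symmetric])
  ultimately show ?thesis by simp
qed

lemma trace_anti_part: "trace (anti_part A) = \<i> * Im (trace A)"
  by (simp add: trace_def anti_part_def sum_distrib_left)

section \<open>Flows driven by lower triangular matrices\<close>

lemma lower_real_diag_nth:
  assumes "P \<in> lower_real_diag"
  shows "i < j \<Longrightarrow> P $ i $ j = 0" "P $ i $ i = of_real (Re (P $ i $ i))"
  using assms by (auto simp: lower_real_diag_def complex_is_Real_iff complex_eq_iff)

text \<open>In a flow by lower triangular matrices an entry only feels the entries weakly above and to the
  right of it; if these vanish, it is rescaled by the real diagonals.\<close>

lemma entry_rescaled:
  fixes X P Q :: "real \<Rightarrow> 'n::{finite,linorder} cmat"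
  assumes der: "\<And>t. t \<in> {0..T} \<Longrightarrow>
      (X has_vector_derivative P t ** X t - X t ** Q t) (at t within {0..T})"
    and P: "\<And>t. P t \<in> lower_real_diag" "continuous_on {0..T} P"
    and Q: "\<And>t. Q t \<in> lower_real_diag" "continuous_on {0..T} Q"
    and zero: "\<And>t k l. t \<in> {0..T} \<Longrightarrow> k \<le> i \<Longrightarrow> j \<le> l \<Longrightarrow> (k, l) \<noteq> (i, j) \<Longrightarrow> X t $ k $ l = 0"
    and t: "t \<in> {0..T}"
  obtains r where "0 < r" "X t $ i $ j = of_real r * X 0 $ i $ j"
proof -
  \<comment> \<open>The entry will obey the scalar equation x' = r x. Since the diagonals are real,
    the integrating factor is the exponential of a real integral and hence positive.\<close>
  define r where "r t = Re (P t $ i $ i) - Re (Q t $ j $ j)" for t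
  have "continuous_on {0..T} r"
    unfolding r_def using P(2) Q(2) by (auto intro!: continuous_intros)
  hence g: "((\<lambda>u. integral {0..u} r) has_vector_derivative r s) (at s within {0..T})"
    if "s \<in> {0..T}" for s
    using that by (rule integral_has_vector_derivative)
  define g where "g u = integral {0..u} r" for u
  have x: "((\<lambda>s. X s $ i $ j) has_vector_derivative r s *\<^sub>R X s $ i $ j) (at s within {0..T})"
    if s: "s \<in> {0..T}" for s
  proof -
    have "(P s ** X s) $ i $ j = P s $ i $ i * X s $ i $ j"
    proof (rule mat_mult_single)
      fix l assume "l \<noteq> i"
      thus "P s $ i $ l = 0 \<or> X s $ l $ j = 0"
        using lower_real_diag_nth(1)[OF P(1)[of s], of i l] zero[OF s, of l j] by (cases "i < l") auto
    qed
    moreover have "(X s ** Q s) $ i $ j = X s $ i $ j * Q s $ j $ j"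
    proof (rule mat_mult_single)
      fix l assume "l \<noteq> j"
      thus "X s $ i $ l = 0 \<or> Q s $ l $ j = 0"
        using lower_real_diag_nth(1)[OF Q(1)[of s], of l j] zero[OF s, of i l] by (cases "l < j") auto
    qed
    ultimately have "(P s ** X s - X s ** Q s) $ i $ j = r s *\<^sub>R X s $ i $ j"
      using lower_real_diag_nth(2)[OF P(1)[of s], of i] lower_real_diag_nth(2)[OF Q(1)[of s], of j]
      by (simp add: r_def scaleR_conv_of_real algebra_simps)
    thus ?thesis using has_vector_derivative_nth[OF der[OF s], of i j] by simp
  qed
  have "((\<lambda>s. exp (- g s) *\<^sub>R X s $ i $ j) has_vector_derivative 0) (at s within {0..T})"
    if s: "s \<in> {0..T}" for s
  proof -
    have "(g has_real_derivative r s) (at s within {0..T})"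
      using g[OF s] by (simp add: g_def[abs_def] has_real_derivative_iff_has_vector_derivative)
    hence "((\<lambda>s. exp (- g s)) has_real_derivative exp (- g s) * - r s) (at s within {0..T})"
      by (auto intro!: derivative_eq_intros)
    from has_vector_derivative_scaleR[OF this x[OF s]]
    show ?thesis by (simp add: algebra_simps)
  qed
  then obtain c where c: "\<And>s. s \<in> {0..T} \<Longrightarrow> exp (- g s) *\<^sub>R X s $ i $ j = c"
    using has_vector_derivative_zero_constant[of "{0..T}" "\<lambda>s. exp (- g s) *\<^sub>R X s $ i $ j"] by auto
  have "X s $ i $ j = exp (g s) *\<^sub>R c" if "s \<in> {0..T}" for s
    using c[OF that] by (metis exp_minus_inverse mult_1 scaleR_one scaleR_scaleR)
  hence "X t $ i $ j = exp (g t) *\<^sub>R c" "X 0 $ i $ j = exp (g 0) *\<^sub>R c" using t by auto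
  hence "X t $ i $ j = of_real (exp (g t - g 0)) * X 0 $ i $ j"
    by (simp add: scaleR_conv_of_real exp_diff field_simps)
  thus ?thesis using that[of "exp (g t - g 0)"] by simp
qed

text \<open>The induction starts at the top right corner of the matrix: the other entries weakly
  above and to the right of (i, j) have smaller measure and already vanish, so this entry is a
  multiple of its initial value 0.\<close>

lemma staircase_zeros:
  fixes X P Q :: "real \<Rightarrow> 'n::{finite,linorder} cmat"
  assumes der: "\<And>t. t \<in> {0..T} \<Longrightarrow>
      (X has_vector_derivative P t ** X t - X t ** Q t) (at t within {0..T})"
    and P: "\<And>t. P t \<in> lower_real_diag" "continuous_on {0..T} P"
    and Q: "\<And>t. Q t \<in> lower_real_diag" "continuous_on {0..T} Q"
    and Z: "\<And>i j k l. Z i j \<Longrightarrow> k \<le> i \<Longrightarrow> j \<le> l \<Longrightarrow> Z k l"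
    and init: "\<And>i j. Z i j \<Longrightarrow> X 0 $ i $ j = 0"
    and "Z i j" "t \<in> {0..T}"
  shows "X t $ i $ j = 0"
  using \<open>Z i j\<close> \<open>t \<in> {0..T}\<close>
proof (induction "pos i + (CARD('n) - pos j)" arbitrary: i j t rule: less_induct)
  case less
  have "X s $ k $ l = 0" if "s \<in> {0..T}" "k \<le> i" "j \<le> l" "(k, l) \<noteq> (i, j)" for s k l
  proof (rule less.hyps)
    have "pos k \<le> pos i" "pos j \<le> pos l" using that by (simp_all add: pos_le_iff)
    moreover have "pos k \<noteq> pos i \<or> pos j \<noteq> pos l" using that(4) by auto
    ultimately show "pos k + (CARD('n) - pos l) < pos i + (CARD('n) - pos j)"
      using pos_less_card[of j] pos_less_card[of l] by linarith
  qed (use that less.prems Z in auto)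
  from entry_rescaled[OF der P Q this less.prems(2)] obtain r
    where "X t $ i $ j = of_real r * X 0 $ i $ j" by blast
  thus ?case using init less.prems by simp
qed

lemma hamiltonian_flow_invariant:
  fixes B B' :: "'n::{finite,linorder} cmat"
  assumes flow: "hamiltonian_flow B B'" and u: "unitary B" and shape: "cmv_shape B"
  shows "unitary B' \<and> cmv_shape B' \<and> det B' = det B"
proof -
  obtain \<phi> \<gamma> T where \<phi>: "smooth \<phi>" and T: "0 \<le> T" and \<gamma>: "\<gamma> 0 = B" "\<gamma> T = B'"
    and der0: "\<And>t. t \<in> {0..T} \<Longrightarrow>
      (\<gamma> has_vector_derivative hamiltonian_field \<phi> (\<gamma> t)) (at t within {0..T})"
    using flow unfolding hamiltonian_flow_def by blast
  define Y where "Y t = grad \<phi> (\<gamma> t)" for t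
  \<comment> \<open>The skew parts A, C and the lower triangular parts P, Q give the two forms of
    the field; passing from one to the other adds and subtracts \<gamma> Y \<gamma>.\<close>
  define A C P Q where "A t = anti_part (Y t ** \<gamma> t)" and "C t = anti_part (\<gamma> t ** Y t)"
    and "P t = \<gamma> t ** Y t - C t" and "Q t = Y t ** \<gamma> t - A t" for t
  have der: "(\<gamma> has_vector_derivative \<gamma> t ** A t - C t ** \<gamma> t) (at t within {0..T})"
    if "t \<in> {0..T}" for t
    using der0[OF that] by (simp add: hamiltonian_field_eq[OF \<phi>] A_def C_def Y_def)
  have adj: "adjoint_mat (A t) = - A t" "adjoint_mat (C t) = - C t" for t
    by (simp_all add: A_def C_def anti_part_adjoint)
  have un: "unitary (\<gamma> t)" if "t \<in> {0..T}" for t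
    using unitary_invariant[OF der adj] u \<gamma> that by simp
  have "((\<lambda>s. det (\<gamma> s)) has_vector_derivative 0) (at t within {0..T})" if t: "t \<in> {0..T}" for t
  proof -
    \<comment> \<open>By unitarity the logarithmic derivative of the determinant is this difference
      of traces; each of them is \<i> times the imaginary part of the common trace of Y \<gamma> and
      \<gamma> Y.\<close>
    have "trace (adjoint_mat (\<gamma> t) ** (\<gamma> t ** A t - C t ** \<gamma> t)) = trace (A t) - trace (C t)"
      using trace_mul_sym[of "adjoint_mat (\<gamma> t)" "C t ** \<gamma> t"] unitaryD[OF un[OF t]]
      by (simp add: mat_mult_diff trace_sub matrix_mul_assoc)
        (metis matrix_mul_assoc matrix_mul_rid)
    also have "\<dots> = 0"
      unfolding A_def C_def trace_anti_part by (subst trace_mul_sym) simp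
    finally show ?thesis
      using det_has_vector_derivative[OF der[OF t] unitaryD(1)[OF un[OF t]]] by simp
  qed
  then obtain c where "\<And>s. s \<in> {0..T} \<Longrightarrow> det (\<gamma> s) = c"
    using has_vector_derivative_zero_constant[of "{0..T}" "\<lambda>s. det (\<gamma> s)"] by auto
  hence det: "det B' = det B" using \<gamma> T by (metis atLeastAtMost_iff order_refl)
  have contg: "continuous_on {0..T} \<gamma>"
    unfolding continuous_on_eq_continuous_within using der has_vector_derivative_continuous by blast
  have contY: "continuous_on {0..T} Y"
    unfolding Y_def by (rule continuous_on_compose2[OF continuous_on_grad[OF \<phi>] contg]) auto
  have cont: "continuous_on {0..T} P" "continuous_on {0..T} Q"
    unfolding P_def Q_def A_def C_def
    by (intro continuous_on_diff continuous_on_mat_mult contg contY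
        bounded_linear.continuous_on[OF bounded_linear_anti_part])+
  have low: "P t \<in> lower_real_diag" "Q t \<in> lower_real_diag" for t
    by (simp_all add: P_def Q_def A_def C_def diff_anti_part_lower)
  have d1: "(\<gamma> has_vector_derivative P t ** \<gamma> t - \<gamma> t ** Q t) (at t within {0..T})"
    if "t \<in> {0..T}" for t
  proof -
    have "P t ** \<gamma> t - \<gamma> t ** Q t = \<gamma> t ** A t - C t ** \<gamma> t"
      by (simp add: P_def Q_def mat_diff_mult mat_mult_diff matrix_mul_assoc)
    thus ?thesis using der[OF that] by simp
  qed
  define D where "D t = adjoint_mat (\<gamma> t)" for t
  \<comment> \<open>Unitarity enters here: since Y \<gamma> D = Y and D \<gamma> Y = Y, the adjoint
    curve obeys an equation of the same lower triangular type, with P and Q exchanged.\<close>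
  have d2: "(D has_vector_derivative Q t ** D t - D t ** P t) (at t within {0..T})"
    if t: "t \<in> {0..T}" for t
  proof -
    have "Y t ** \<gamma> t ** D t = Y t" "D t ** (\<gamma> t ** Y t) = Y t"
      using unitaryD[OF un[OF t]] by (simp_all add: D_def matrix_mul_assoc flip: matrix_mul_assoc[of "Y t"])
    hence "Q t ** D t - D t ** P t = adjoint_mat (\<gamma> t ** A t - C t ** \<gamma> t)"
      by (simp add: P_def Q_def mat_diff_mult mat_mult_diff adjoint_mat_diff adjoint_mat_mult adj
          mat_mult_uminus mat_uminus_mult D_def)
    thus ?thesis
      using bounded_linear.has_vector_derivative[OF bounded_linear_adjoint_mat der[OF t]]
      by (simp add: D_def[abs_def])
  qed
  have D0: "D 0 $ i $ j = cnj (B $ j $ i)" "D T $ i $ j = cnj (B' $ j $ i)" for i j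
    by (simp_all add: D_def \<gamma> adjoint_mat_def)
  \<comment> \<open>U is the zero region above the band of \<gamma>. V is the one below it, written
    in the indices of the adjoint, where it also extends upwards and to the right.\<close>
  define U where "U i j \<longleftrightarrow> pos i div 2 + 1 < (pos j + 1) div 2" for i j :: 'n
  define V where "V i j \<longleftrightarrow> (pos i + 1) div 2 < pos j div 2" for i j :: 'n
  have zB: "B $ i $ j = 0" if "U i j \<or> V j i" for i j
    using shape that unfolding cmv_shape_def cmv_zeros_def U_def V_def by force
  have U: "\<gamma> t $ i $ j = 0" if "U i j" "t \<in> {0..T}" for i j t
  proof (rule staircase_zeros[OF d1 low(1) cont(1) low(2) cont(2), where Z = U])
    show "U k l" if "U i j" "k \<le> i" "j \<le> l" for i j k l
    proof -
      have "pos k div 2 \<le> pos i div 2" "(pos j + 1) div 2 \<le> (pos l + 1) div 2"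
        using that by (auto intro!: div_le_mono simp: pos_le_iff)
      thus ?thesis using that by (simp add: U_def)
    qed
  qed (use that zB \<gamma> in auto)
  have V: "D t $ i $ j = 0" if "V i j" "t \<in> {0..T}" for i j t
  proof (rule staircase_zeros[OF d2 low(2) cont(2) low(1) cont(1), where Z = V])
    show "V k l" if "V i j" "k \<le> i" "j \<le> l" for i j k l
    proof -
      have "(pos k + 1) div 2 \<le> (pos i + 1) div 2" "pos j div 2 \<le> pos l div 2"
        using that by (auto intro!: div_le_mono simp: pos_le_iff)
      thus ?thesis using that by (simp add: V_def)
    qed
  qed (use that zB D0 in auto)
  have TT: "T \<in> {0..T}" using T by simp
  have "cmv_zeros B'"
    unfolding cmv_zeros_def
  proof (intro allI impI)
    fix i j assume "B' $ i $ j \<noteq> 0"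
    hence "\<not> U i j" "\<not> V j i"
      using U[OF _ TT, of i j] V[OF _ TT, of j i] \<gamma> D0 by auto
    thus "(pos j + 1) div 2 = pos i div 2 \<or> (pos j + 1) div 2 = pos i div 2 + 1"
      unfolding U_def V_def by linarith
  qed
  moreover have "pos_real (B' $ i $ j)" if c: "corner k i j" for k i j
  proof (cases "even k")
    case False
    hence ij: "pos i = k - 1" "pos j = Suc k" using c by (auto simp: corner_def)
    \<comment> \<open>Everything else weakly above and to the right of an odd corner lies in the
      zero region, so the corner is only rescaled. Even corners are treated in the same way as
      entries of the adjoint.\<close>
    have "\<gamma> t $ p $ q = 0" if "t \<in> {0..T}" "p \<le> i" "j \<le> q" "(p, q) \<noteq> (i, j)" for t p q
    proof (rule U)
      have "pos p \<le> pos i" "pos j \<le> pos q" using that by (simp_all add: pos_le_iff)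
      moreover have "pos p \<noteq> pos i \<or> pos q \<noteq> pos j" using that(4) by auto
      ultimately show "U p q" using False unfolding U_def ij by presburger
    qed (use that in auto)
    from entry_rescaled[OF d1 low(1) cont(1) low(2) cont(2) this TT] obtain r
      where "0 < r" "B' $ i $ j = of_real r * B $ i $ j" using \<gamma> by auto
    thus ?thesis using shape c by (auto simp: cmv_shape_def pos_real_mult_of_real)
  next
    case True
    hence ij: "pos i = Suc k" "pos j = k - 1" using c by (auto simp: corner_def)
    have "D t $ p $ q = 0" if "t \<in> {0..T}" "p \<le> j" "i \<le> q" "(p, q) \<noteq> (j, i)" for t p q
    proof (rule V)
      have "pos p \<le> pos j" "pos i \<le> pos q" using that by (simp_all add: pos_le_iff)
      moreover have "pos p \<noteq> pos j \<or> pos q \<noteq> pos i" using that(4) by auto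
      ultimately show "V p q" using True unfolding V_def ij by presburger
    qed (use that in auto)
    from entry_rescaled[OF d2 low(2) cont(2) low(1) cont(1) this TT] obtain r
      where "0 < r" "cnj (B' $ i $ j) = of_real r * cnj (B $ i $ j)" using D0 by auto
    hence "0 < r" "B' $ i $ j = of_real r * B $ i $ j"
      by (metis complex_cnj_cnj complex_cnj_complex_of_real complex_cnj_mult)+
    thus ?thesis using shape c by (auto simp: cmv_shape_def pos_real_mult_of_real)
  qed
  ultimately show ?thesis using un[OF TT] \<gamma> det by (auto simp: cmv_shape_def)
qed

section \<open>Moving a single coefficient\<close>

definition diag_mat :: "('n \<Rightarrow> complex) \<Rightarrow> 'n::finite cmat" where
  "diag_mat d = (\<chi> i j. if i = j then d i else 0)"

lemma diag_mat_nth: "diag_mat d $ i $ j = (if i = j then d i else 0)"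
  by (simp add: diag_mat_def)

lemma mat_mult_diag_mat: "(A ** diag_mat d) $ i $ j = A $ i $ j * d j"
  by (subst mat_mult_single[of j]) (auto simp: diag_mat_nth)

lemma diag_mat_mult: "(diag_mat d ** A) $ i $ j = d i * A $ i $ j"
  by (subst mat_mult_single[of i]) (auto simp: diag_mat_nth)

lemma mat_mult_elem_mat: "(A ** elem_mat p q z) $ i $ j = (if j = q then A $ i $ p * z else 0)"
  by (subst mat_mult_single[of p]) (auto simp: elem_mat_nth)

lemma elem_mat_mult: "(elem_mat p q z ** A) $ i $ j = (if i = p then z * A $ q $ j else 0)"
  by (subst mat_mult_single[of q]) (auto simp: elem_mat_nth)

lemma adjoint_elem_mat: "adjoint_mat (elem_mat p q z) = elem_mat q p (cnj z)"
  by (auto simp: vec_eq_iff adjoint_mat_def elem_mat_nth)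

text \<open>Block diagonality with a cut between the indices k and k + 1. Among the blocks of a CMV
  matrix only \<Xi>_k straddles this cut.\<close>

definition split_at :: "nat \<Rightarrow> 'n::{finite,linorder} cmat \<Rightarrow> bool" where
  "split_at k U \<longleftrightarrow> (\<forall>i j. U $ i $ j \<noteq> 0 \<longrightarrow> (pos i \<le> k \<longleftrightarrow> pos j \<le> k))"

lemma split_at_adjoint: "split_at k (adjoint_mat U) \<longleftrightarrow> split_at k U"
  by (auto simp: split_at_def adjoint_mat_def)

definition level_mat :: "nat \<Rightarrow> complex \<Rightarrow> 'n::{finite,linorder} cmat" where
  "level_mat k s = diag_mat (\<lambda>i. if pos i \<le> k then s else 0)"

lemma level_mat_commute: "split_at k U \<Longrightarrow> U ** level_mat k s = level_mat k s ** U"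
  by (auto simp: vec_eq_iff level_mat_def mat_mult_diag_mat diag_mat_mult split_at_def)

lemma anti_part_add: "anti_part (A + B) = anti_part A + anti_part B"
  by (rule linear_add[OF bounded_linear.linear[OF bounded_linear_anti_part]])

lemma anti_part_level_mat: "anti_part (level_mat k s) = level_mat k (\<i> * Im s)"
  by (auto simp: vec_eq_iff anti_part_def level_mat_def diag_mat_nth)

lemma anti_part_strict_upper:
  "(\<And>i j. j \<le> i \<Longrightarrow> N $ i $ j = 0) \<Longrightarrow> anti_part N = N - adjoint_mat N"
  by (auto simp: vec_eq_iff anti_part_def adjoint_mat_def less_imp_le not_less)

lemma anti_part_strict_lower: "(\<And>i j. i \<le> j \<Longrightarrow> N $ i $ j = 0) \<Longrightarrow> anti_part N = 0"
  by (auto simp: vec_eq_iff anti_part_def)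

lemma split_conj_elem_mat:
  assumes "split_at k U" "split_at k W"
    and "(U ** elem_mat p q z ** W) $ i $ j \<noteq> 0"
  shows "(pos i \<le> k \<longleftrightarrow> pos p \<le> k) \<and> (pos q \<le> k \<longleftrightarrow> pos j \<le> k)"
proof -
  have "(U ** (elem_mat p q z ** W)) $ i $ j = U $ i $ p * (z * W $ q $ j)"
    by (subst mat_mult_single[of p]) (auto simp: elem_mat_mult)
  thus ?thesis using assms by (auto simp: split_at_def matrix_mul_assoc)
qed

section \<open>Hamiltonian flow of one embedded block\<close>

locale block_position =
  fixes k :: nat and e f :: "'n::{finite,linorder}"
  assumes pos_e: "pos e = k" and pos_f: "pos f = Suc k"
begin

lemma eq_iff: "i = e \<longleftrightarrow> pos i = k" "i = f \<longleftrightarrow> pos i = Suc k"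
  using pos_e pos_f by (metis pos_eq_iff)+

lemma e_neq_f [simp]: "e \<noteq> f" "f \<noteq> e"
  using pos_e pos_f by force+

abbreviation block :: "complex \<Rightarrow> 'n cmat" where
  "block a \<equiv> xi_diag {k} (\<lambda>_. a)"

lemma block_nth:
  "block a $ i $ j = (if i = e \<and> j = e then cnj a else if i = f \<and> j = f then - a
     else if i = e \<and> j = f \<or> i = f \<and> j = e then of_real (rho a) else if i = j then 1 else 0)"
proof -
  have "xi_entry {k} (\<lambda>_. a) p q = (if p = k \<and> q = k then cnj a else if p = Suc k \<and> q = Suc k then - a
     else if p = k \<and> q = Suc k \<or> p = Suc k \<and> q = k then of_real (rho a) else if p = q then 1 else 0)" for p q
    by (cases p) (auto simp: xi_entry_def)
  thus ?thesis unfolding xi_diag_nth eq_iff by simp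
qed

text \<open>These are c times the diagonal cofactors of diag(1, ..., 1, cnj a), the leading corner
  of size k + 1 of \<open>block a\<close>, that is, the derivatives of c times its determinant in
  the diagonal entries.\<close>

definition weights :: "complex \<Rightarrow> complex \<Rightarrow> 'n \<Rightarrow> complex" where
  "weights c a i = c * (if i < e then cnj a else if i = e then 1 else 0)"

lemma less_e_iff: "i < e \<longleftrightarrow> pos i < k"
  using pos_less_iff[of i e] pos_e by simp

lemma f_not_less_e: "\<not> f < e"
  by (simp add: less_e_iff pos_f)

text \<open>The witness is a quadratic polynomial that agrees to first order, at all these points, with a
  multiple of the leading principal minor of size \<open>k + 1\<close> of \<open>U\<^sup>* X W\<^sup>*\<close>.\<close>

lemma block_hamiltonian:
  assumes U: "unitary U" and W: "unitary W"
  obtains \<phi> where "smooth \<phi>"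
    "\<And>a. grad \<phi> (U ** block a ** W) = adjoint_mat W ** diag_mat (weights c a) ** adjoint_mat U"
proof -
  define h where "h i X = (adjoint_mat U ** X ** adjoint_mat W) $ i $ i" for i and X :: "'n cmat"
  have h: "linear (h i)" for i
    by (rule linearI) (simp_all add: h_def matrix_add_ldistrib mat_add_mult mat_scaleR_mult mat_mult_scaleR)
  note h_simps = linear_add[OF h] linear_scale[OF h]
  \<comment> \<open>At the points in question the diagonal entries \<open>h i\<close> with i < e
    equal 1. There the product of \<open>h e\<close> with these k entries agrees to first order with
    \<open>h e\<close> times their sum plus 1 - k; the sum gives b, and 1 - k gives l.\<close>
  define b where "b X Y = Im (c * (h e X * (\<Sum>i | i < e. h i Y)))" for X Y
  define l where "l X = Im (c * (1 - of_nat k) * h e X)" for X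
  have b: "bounded_bilinear b"
    unfolding bilinear_conv_bounded_bilinear[symmetric] bilinear_def
    by (auto intro!: linearI simp: b_def h_simps sum.distrib algebra_simps simp flip: scaleR_sum_right)
  have l: "bounded_linear l"
    unfolding linear_conv_bounded_linear[symmetric]
    by (auto intro!: linearI simp: l_def h_simps algebra_simps)
  have gr: "grad (\<lambda>X. b X X + l X) (U ** block a ** W) =
      adjoint_mat W ** diag_mat (weights c a) ** adjoint_mat U" for a
  proof (rule grad_eqI)
    let ?B = "U ** block a ** W"
    let ?Y = "adjoint_mat W ** diag_mat (weights c a) ** adjoint_mat U"
    have "adjoint_mat U ** ?B ** adjoint_mat W =
        (adjoint_mat U ** U) ** block a ** (W ** adjoint_mat W)"
      by (simp add: matrix_mul_assoc)
    hence hB: "h i ?B = block a $ i $ i" for i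
      by (simp add: h_def unitaryD U W)
    have he: "h e ?B = cnj a" by (simp add: hB block_nth)
    have "(\<Sum>i | i < e. h i ?B) = (\<Sum>i | i < e. 1)"
      unfolding hB
    proof (rule sum.cong)
      fix i assume "i \<in> {i. i < e}"
      hence "i \<noteq> e" "i \<noteq> f" using f_not_less_e by auto
      thus "block a $ i $ i = 1" by (simp add: block_nth)
    qed simp
    hence hs: "(\<Sum>i | i < e. h i ?B) = of_nat k"
      using pos_e by (simp add: pos_def)
    have "b ?B v + b v ?B + l v = pairing ?Y v" for v
    proof -
      have "b ?B v + b v ?B + l v = Im (c * cnj a * (\<Sum>i | i < e. h i v) + c * h e v)"
        unfolding b_def l_def hs he by (simp add: algebra_simps)
      also have "c * cnj a * (\<Sum>i | i < e. h i v) + c * h e v = (\<Sum>i\<in>{i. i < e} \<union> {e}. weights c a i * h i v)"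
        by (subst sum.union_disjoint) (auto simp: weights_def sum_distrib_left mult.assoc)
      also have "\<dots> = (\<Sum>i\<in>UNIV. weights c a i * h i v)"
        by (rule sum.mono_neutral_left) (auto simp: weights_def)
      also have "\<dots> = trace (diag_mat (weights c a) ** (adjoint_mat U ** v ** adjoint_mat W))"
        by (simp add: trace_def diag_mat_mult h_def)
      also have "\<dots> = trace (?Y ** v)"
        using trace_mul_sym[of "adjoint_mat W" "diag_mat (weights c a) ** (adjoint_mat U ** v)"]
        by (simp add: matrix_mul_assoc)
      finally show ?thesis by (simp add: pairing_def)
    qed
    hence "(\<lambda>v. b ?B v + b v ?B + l v) = pairing ?Y" by (rule ext)
    moreover have "((\<lambda>X. b X X + l X) has_derivative (\<lambda>v. b ?B v + b v ?B + l v)) (at ?B)"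
      using bounded_bilinear.FDERIV[OF b has_derivative_ident has_derivative_ident]
        bounded_linear_imp_has_derivative[OF l] by (auto intro!: derivative_eq_intros)
    ultimately show "((\<lambda>X. b X X + l X) has_derivative pairing ?Y) (at ?B)" by simp
  qed
  show ?thesis
    using smooth_bilinear_linear[OF b l] gr by (rule that)
qed

text \<open>Because U and W respect the cut, YB is a scalar before the cut plus a strictly upper
  term N, and BY is the same scalar plus a strictly lower term. The skew projection turns N into N
  minus its adjoint and kills the lower term. What is left lives on the two-by-two block and is the
  tangent vector belonging to the velocity \<open>- c * (rho a)\<^sup>2\<close> of a.\<close>

lemma hamiltonian_field_block:
  assumes U: "unitary U" "split_at k U" and W: "unitary W" "split_at k W" and \<phi>: "smooth \<phi>"
    and gr: "grad \<phi> (U ** block a ** W) = adjoint_mat W ** diag_mat (weights c a) ** adjoint_mat U"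
  shows "hamiltonian_field \<phi> (U ** block a ** W) = U **
    (elem_mat e e (- cnj c * (rho a)\<^sup>2) + elem_mat f f (c * (rho a)\<^sup>2)
     + elem_mat e f (rho a * Re (c * cnj a)) + elem_mat f e (rho a * Re (c * cnj a))) ** W"
proof -
  let ?B = "U ** block a ** W" and ?G = "block a"
  let ?D = "diag_mat (weights c a)"
  let ?Y = "adjoint_mat W ** ?D ** adjoint_mat U"
  define z where "z = c * cnj a"
  define N where "N = adjoint_mat W ** elem_mat e f (c * rho a) ** W"
  define N' where "N' = U ** elem_mat f e (c * rho a) ** adjoint_mat U"
  have le: "pos i \<le> k \<longleftrightarrow> i < e \<or> i = e" for i
    unfolding less_e_iff eq_iff by auto
  have lm: "level_mat k s $ i $ j = (if i = j \<and> (i < e \<or> i = e) then s else 0)" for s i j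
    unfolding level_mat_def diag_mat_nth le by simp
  have wt: "weights c a i = (if i < e then z else if i = e then c else 0)" for i
    by (simp add: weights_def z_def)
  have DG: "?D ** ?G = level_mat k z + elem_mat e f (c * rho a)"
  proof -
    have "(?D ** ?G) $ i $ j = (level_mat k z + elem_mat e f (c * rho a)) $ i $ j" for i j
      unfolding diag_mat_mult block_nth vector_add_component lm elem_mat_nth wt
      using f_not_less_e by (cases "i = j"; cases "i = e"; cases "i = f"; cases "j = e"; cases "j = f"; simp add: z_def)
    thus ?thesis by (simp add: vec_eq_iff)
  qed
  have GD: "?G ** ?D = level_mat k z + elem_mat f e (c * rho a)"
  proof -
    have "(?G ** ?D) $ i $ j = (level_mat k z + elem_mat f e (c * rho a)) $ i $ j" for i j
      unfolding mat_mult_diag_mat block_nth vector_add_component lm elem_mat_nth wt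
      using f_not_less_e by (cases "i = j"; cases "i = e"; cases "i = f"; cases "j = e"; cases "j = f"; simp add: z_def)
    thus ?thesis by (simp add: vec_eq_iff)
  qed
  have "?Y ** ?B = adjoint_mat W ** (?D ** (adjoint_mat U ** U) ** ?G) ** W"
    by (simp add: matrix_mul_assoc)
  also have "\<dots> = adjoint_mat W ** (level_mat k z + elem_mat e f (c * rho a)) ** W"
    by (simp add: unitaryD U DG)
  also have "\<dots> = adjoint_mat W ** level_mat k z ** W + N"
    by (simp add: N_def matrix_add_ldistrib mat_add_mult)
  also have "adjoint_mat W ** level_mat k z ** W = level_mat k z"
    using W by (simp add: level_mat_commute split_at_adjoint unitaryD flip: matrix_mul_assoc)
  finally have YB: "?Y ** ?B = level_mat k z + N" .
  have "?B ** ?Y = U ** (?G ** (W ** adjoint_mat W) ** ?D) ** adjoint_mat U"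
    by (simp add: matrix_mul_assoc)
  also have "\<dots> = U ** (level_mat k z + elem_mat f e (c * rho a)) ** adjoint_mat U"
    by (simp add: unitaryD W GD)
  also have "\<dots> = U ** level_mat k z ** adjoint_mat U + N'"
    by (simp add: N'_def matrix_add_ldistrib mat_add_mult)
  also have "U ** level_mat k z ** adjoint_mat U = level_mat k z"
    using U by (simp add: level_mat_commute unitaryD flip: matrix_mul_assoc)
  finally have BY: "?B ** ?Y = level_mat k z + N'" .
  have "N $ i $ j = 0" if "j \<le> i" for i j
  proof (rule ccontr)
    assume "N $ i $ j \<noteq> 0"
    hence "pos i \<le> k" "\<not> pos j \<le> k"
      using split_conj_elem_mat[of k "adjoint_mat W" W e f] W pos_e pos_f
      by (auto simp: N_def split_at_adjoint)
    thus False using that by (simp flip: pos_le_iff)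
  qed
  hence A1: "anti_part (?Y ** ?B) = level_mat k (\<i> * Im z) + N - adjoint_mat N"
    by (simp add: YB anti_part_add anti_part_level_mat anti_part_strict_upper)
  have "N' $ i $ j = 0" if "i \<le> j" for i j
  proof (rule ccontr)
    assume "N' $ i $ j \<noteq> 0"
    hence "\<not> pos i \<le> k" "pos j \<le> k"
      using split_conj_elem_mat[of k U "adjoint_mat U" f e] U pos_e pos_f
      by (auto simp: N'_def split_at_adjoint)
    thus False using that by (simp flip: pos_le_iff)
  qed
  hence A2: "anti_part (?B ** ?Y) = level_mat k (\<i> * Im z)"
    by (simp add: BY anti_part_add anti_part_level_mat anti_part_strict_lower)
  let ?s = "level_mat k (\<i> * Im z) :: 'n cmat"
  have adjN: "adjoint_mat N = adjoint_mat W ** elem_mat f e (cnj c * rho a) ** W"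
    by (simp add: N_def adjoint_mat_mult adjoint_elem_mat matrix_mul_assoc)
  have BW: "?B ** (adjoint_mat W ** X ** W) = U ** (?G ** X) ** W" for X
  proof -
    have "?B ** (adjoint_mat W ** X ** W) = U ** ?G ** (W ** adjoint_mat W) ** X ** W"
      by (simp add: matrix_mul_assoc)
    thus ?thesis by (simp add: unitaryD W matrix_mul_assoc)
  qed
  have Bs: "?B ** ?s = U ** (?G ** ?s) ** W"
    using level_mat_commute[OF W(2)] by (simp flip: matrix_mul_assoc)
  have sB: "?s ** ?B = U ** (?s ** ?G) ** W"
    using level_mat_commute[OF U(2)] by (simp add: matrix_mul_assoc)
  have "hamiltonian_field \<phi> ?B = ?B ** (?s + N - adjoint_mat N) - ?s ** ?B"
    by (simp only: hamiltonian_field_eq[OF \<phi>] gr A1 A2)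
  also have "\<dots> = U ** (?G ** ?s + ?G ** elem_mat e f (c * rho a) - ?G ** elem_mat f e (cnj c * rho a)
      - ?s ** ?G) ** W"
    unfolding mat_mult_diff matrix_add_ldistrib Bs sB adjN
    unfolding N_def BW mat_diff_mult mat_add_mult ..
  also have "?G ** ?s + ?G ** elem_mat e f (c * rho a) - ?G ** elem_mat f e (cnj c * rho a) - ?s ** ?G =
     elem_mat e e (- cnj c * (rho a)\<^sup>2) + elem_mat f f (c * (rho a)\<^sup>2)
     + elem_mat e f (rho a * Re (c * cnj a)) + elem_mat f e (rho a * Re (c * cnj a))" (is "?l = ?r")
  proof -
    have "?l $ i $ j = ?r $ i $ j" for i j
    proof -
      have s: "(?s ** ?G) $ i $ j = (if i < e \<or> i = e then \<i> * Im z * ?G $ i $ j else 0)"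
        "(?G ** ?s) $ i $ j = (if j < e \<or> j = e then ?G $ i $ j * (\<i> * Im z) else 0)"
        unfolding level_mat_def mat_mult_diag_mat diag_mat_mult le by simp_all
      show ?thesis
        unfolding vector_add_component vector_minus_component s mat_mult_elem_mat elem_mat_nth block_nth
        using f_not_less_e by (cases "i = j"; cases "i = e"; cases "i = f"; cases "j = e"; cases "j = f";
            simp add: z_def complex_eq_iff power2_eq_square algebra_simps)
    qed
    thus ?thesis by (simp add: vec_eq_iff)
  qed
  finally show ?thesis .
qed

text \<open>Along a = c tanh t with |c| = 1 the value of \<open>rho\<close> is 1 / cosh t, so the
  curve combines three constant matrices with explicit scalar functions. The derivative is written
  as the field formula gives it for - c in place of c.\<close>

lemma block_curve_derivative:
  assumes c: "cmod c = 1"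
  defines "a \<equiv> \<lambda>t. c * of_real (tanh t)"
  shows "((\<lambda>t. block (a t)) has_vector_derivative
    (elem_mat e e (cnj c * (rho (a t))\<^sup>2) + elem_mat f f (- c * (rho (a t))\<^sup>2)
     + elem_mat e f (rho (a t) * Re (- c * cnj (a t))) + elem_mat f e (rho (a t) * Re (- c * cnj (a t)))))
    (at t within S)"
proof -
  define E where "E = diag_mat (\<lambda>i. if i = e \<or> i = f then 0 else 1)"
  define A1 where "A1 = elem_mat e e (cnj c) + elem_mat f f (- c)"
  define A2 where "A2 = elem_mat e f 1 + elem_mat f e 1"
  have ca: "cmod (a t) = \<bar>tanh t\<bar>" for t by (simp add: a_def norm_mult c)
  have sq: "1 - (tanh t)\<^sup>2 = inverse (cosh t) ^ 2" for t :: real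
  proof -
    have "1 - (tanh t)\<^sup>2 = ((cosh t)\<^sup>2 - (sinh t)\<^sup>2) / (cosh t)\<^sup>2"
      by (simp add: tanh_def power_divide diff_divide_distrib)
    also have "(cosh t)\<^sup>2 - (sinh t)\<^sup>2 = 1" using cosh_square_eq[of t] by simp
    finally show ?thesis by (simp add: inverse_eq_divide power_divide)
  qed
  have rho: "rho (a t) = inverse (cosh t)" for t
    by (simp add: rho_def ca sq cosh_real_pos less_imp_le real_sqrt_abs)
  have cc: "c * cnj c = 1" using c by (simp add: complex_norm_square[symmetric])
  have re: "Re (- c * cnj (a t)) = - tanh t"
  proof -
    have "- c * cnj (a t) = - of_real (tanh t)"
      using cc by (simp add: a_def mult.assoc[symmetric])
    thus ?thesis by simp
  qed
  have "block (a t) = E + tanh t *\<^sub>R A1 + inverse (cosh t) *\<^sub>R A2" for t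
  proof -
    have "block (a t) $ i $ j = (E + tanh t *\<^sub>R A1 + inverse (cosh t) *\<^sub>R A2) $ i $ j" for i j
      unfolding vector_add_component vector_scaleR_component block_nth E_def A1_def A2_def
        diag_mat_nth elem_mat_nth rho
      by (cases "i = j"; cases "i = e"; cases "i = f"; cases "j = e"; cases "j = f";
          simp add: a_def scaleR_conv_of_real)
    thus ?thesis by (simp add: vec_eq_iff)
  qed
  moreover have "((\<lambda>t. E + tanh t *\<^sub>R A1 + inverse (cosh t) *\<^sub>R A2) has_vector_derivative
      0 + (1 - (tanh t)\<^sup>2) *\<^sub>R A1 + (- (inverse (cosh t) * tanh t)) *\<^sub>R A2) (at t within S)"
  proof -
    have d1: "(tanh has_real_derivative 1 - (tanh t)\<^sup>2) (at t within S)"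
      by (auto intro!: derivative_eq_intros)
    have d2: "((\<lambda>t. inverse (cosh t)) has_real_derivative - (inverse (cosh t) * tanh t)) (at t within S)"
      by (auto intro!: derivative_eq_intros simp: tanh_def field_simps)
    show ?thesis
      using has_vector_derivative_scaleR[OF d1 has_vector_derivative_const, of A1]
        has_vector_derivative_scaleR[OF d2 has_vector_derivative_const, of A2]
      by (intro has_vector_derivative_add has_vector_derivative_const) simp_all
  qed
  moreover have "0 + (1 - (tanh t)\<^sup>2) *\<^sub>R A1 + (- (inverse (cosh t) * tanh t)) *\<^sub>R A2 =
    elem_mat e e (cnj c * (rho (a t))\<^sup>2) + elem_mat f f (- c * (rho (a t))\<^sup>2)
     + elem_mat e f (rho (a t) * Re (- c * cnj (a t))) + elem_mat f e (rho (a t) * Re (- c * cnj (a t)))"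
    unfolding re vec_eq_iff A1_def A2_def vector_add_component vector_scaleR_component elem_mat_nth rho sq
    by (auto simp: scaleR_conv_of_real)
  ultimately show ?thesis by simp
qed

lemma hamiltonian_flow_block:
  assumes U: "unitary U" "split_at k U" and W: "unitary W" "split_at k W" and a: "cmod a < 1"
  shows "hamiltonian_flow (U ** block 0 ** W) (U ** block a ** W)"
proof -
  \<comment> \<open>\<open>sgn 0\<close> is 0 and hence not unimodular; for a = 0 any direction
    serves, since the travel time is then 0.\<close>
  define c where "c = (if a = 0 then 1 else sgn a)"
  have c: "cmod c = 1" by (simp add: c_def norm_sgn)
  have ac: "a = c * of_real (cmod a)"
    by (simp add: c_def sgn_div_norm scaleR_conv_of_real)
  define T where "T = artanh (cmod a)"
  have thT: "tanh T = cmod a"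
  proof -
    have "exp (2 * T) = (1 + cmod a) / (1 - cmod a)"
      unfolding T_def artanh_def using a by (simp add: add_nonneg_pos add_pos_nonneg)
    hence "exp (- (2 * T)) = (1 - cmod a) / (1 + cmod a)"
      by (simp add: exp_minus)
    hence "tanh T = (1 - (1 - cmod a) / (1 + cmod a)) / (1 + (1 - cmod a) / (1 + cmod a))"
      by (simp add: tanh_real_altdef)
    also have "\<dots> = cmod a"
    proof -
      have "1 + cmod a \<noteq> 0" by (metis add_nonneg_eq_0_iff norm_ge_zero zero_le_one zero_neq_one)
      thus ?thesis by (simp add: field_simps)
    qed
    finally show ?thesis .
  qed
  have T: "0 \<le> T" using thT by (metis norm_ge_zero tanh_real_nonneg_iff)
  \<comment> \<open>The sign is chosen so that a moves with velocity
    \<open>c * (rho a)\<^sup>2\<close>. One \<phi> serves the whole curve, as its gradient is known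
    for all a at once.\<close>
  obtain \<phi> where \<phi>: "smooth \<phi>"
    and gr: "\<And>a. grad \<phi> (U ** block a ** W) = adjoint_mat W ** diag_mat (weights (- c) a) ** adjoint_mat U"
    using block_hamiltonian[OF U(1) W(1), of "- c"] by blast
  define \<gamma> where "\<gamma> t = U ** block (c * of_real (tanh t)) ** W" for t
  have "(\<gamma> has_vector_derivative hamiltonian_field \<phi> (\<gamma> t)) (at t within {0..T})" for t
  proof -
    let ?a = "c * of_real (tanh t)"
    have "bounded_linear (\<lambda>X. U ** X ** W)"
      by (rule bounded_linear_compose[OF bounded_bilinear.bounded_linear_left[OF bounded_bilinear_mat_mult]
          bounded_bilinear.bounded_linear_right[OF bounded_bilinear_mat_mult]])
    from bounded_linear.has_vector_derivative[OF this block_curve_derivative[OF c, of t "{0..T}"]]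
    show ?thesis
      unfolding \<gamma>_def hamiltonian_field_block[OF U W \<phi> gr] by simp
  qed
  moreover have "\<gamma> 0 = U ** block 0 ** W" "\<gamma> T = U ** block a ** W"
    using ac by (simp_all add: \<gamma>_def thT)
  ultimately show ?thesis
    unfolding hamiltonian_flow_def using \<phi> T by blast
qed

end

section \<open>Single coefficients and the path from the base point\<close>

lemma split_at_xi_diag:
  assumes "k \<notin> K"
  shows "split_at k (xi_diag K \<alpha>)"
  unfolding split_at_def xi_diag_nth
proof (intro allI impI)
  fix i j assume "xi_entry K \<alpha> (pos i) (pos j) \<noteq> 0"
  from xi_entry_support[OF this] assms show "pos i \<le> k \<longleftrightarrow> pos j \<le> k"
    by (auto simp: Suc_le_eq order_le_less)
qed

text \<open>The block is pulled to the side of its own factor that faces the other factor: to the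
  right of \<L> for even k, to the left of \<M> for odd k. What remains on either side respects the
  cut and is independent of a, so varying a traces a curve with fixed U and W.\<close>

lemma cmv_block_factors:
  assumes \<alpha>: "cmv_coeffs CARD('n) \<alpha>" and k: "Suc k < CARD('n)"
  obtains U W :: "'n::{finite,linorder} cmat" where "unitary U" "split_at k U" "unitary W" "split_at k W"
    "\<And>a. cmv (\<alpha>(k := a)) = U ** xi_diag {k} (\<lambda>_. a) ** W"
proof -
  let ?P = "\<lambda>e. parity_below e CARD('n)"
  let ?X = "\<lambda>K. xi_diag K \<alpha> :: 'n cmat"
  have same: "xi_diag K (\<alpha>(k := a)) = ?X K" if "k \<notin> K" for K a
    by (rule xi_diag_cong) (use that in auto)
  have single: "xi_diag {k} (\<alpha>(k := a)) = (xi_diag {k} (\<lambda>_. a) :: 'n cmat)" for a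
    by (rule xi_diag_cong) auto
  have un: "unitary (?X K)" if "K \<subseteq> ?P e" for K e
    using \<alpha> that by (rule unitary_xi_diag_coeffs)
  define e where "e = even k"
  let ?K = "?P e - {k}"
  have K: "k \<notin> ?K" "Suc k \<notin> ?K" "k = 0 \<or> k - 1 \<notin> ?K" "insert k ?K = ?P e" "k \<notin> ?P (\<not> e)"
    using k by (auto simp: e_def parity_below_def)
  have ins: "xi_diag (?P e) (\<alpha>(k := a)) = ?X ?K ** xi_diag {k} (\<lambda>_. a)"
    "xi_diag (?P e) (\<alpha>(k := a)) = xi_diag {k} (\<lambda>_. a) ** ?X ?K" for a
    using xi_diag_insert[OF K(1-3), of "\<alpha>(k := a)", where 'n='n] same[OF K(1)] single K(4) by simp_all
  have oth: "xi_diag (?P (\<not> e)) (\<alpha>(k := a)) = ?X (?P (\<not> e))" for a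
    using K(5) by (rule same)
  have uK: "unitary (?X ?K)" by (rule un[of _ e]) auto
  have uP: "unitary (?X (?P (\<not> e)))" by (rule un[of _ "\<not> e"]) auto
  have sK: "split_at k (?X ?K)" and sP: "split_at k (?X (?P (\<not> e)))"
    using K by (auto intro: split_at_xi_diag)
  show ?thesis
  proof (cases "even k")
    case True
    have "cmv (\<alpha>(k := a)) = ?X ?K ** xi_diag {k} (\<lambda>_. a) ** ?X (?P (\<not> e))" for a
      using ins(1)[of a] oth[of a] True by (simp add: cmv_eq e_def)
    thus ?thesis by (rule that[OF uK sK uP sP])
  next
    case False
    have "cmv (\<alpha>(k := a)) = ?X (?P (\<not> e)) ** xi_diag {k} (\<lambda>_. a) ** ?X ?K" for a
      using ins(2)[of a] oth[of a] False by (simp add: cmv_eq e_def matrix_mul_assoc)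
    thus ?thesis by (rule that[OF uP sP uK sK])
  qed
qed

lemma hamiltonian_flow_coeff:
  assumes \<alpha>: "cmv_coeffs CARD('n) \<alpha>" and k: "Suc k < CARD('n)"
  shows "hamiltonian_flow (cmv (\<alpha>(k := 0))) (cmv \<alpha> :: 'n::{finite,linorder} cmat)"
proof -
  obtain U W :: "'n cmat" where UW: "unitary U" "split_at k U" "unitary W" "split_at k W"
    and cmv: "\<And>a. cmv (\<alpha>(k := a)) = U ** xi_diag {k} (\<lambda>_. a) ** W"
    using cmv_block_factors[OF \<alpha> k] by blast
  obtain e f :: 'n where "pos e = k" "pos f = Suc k"
    using k by (metis pos_surj Suc_lessD)
  then interpret block_position k e f by unfold_locales
  have "cmod (\<alpha> k) < 1" using \<alpha> k by (simp add: cmv_coeffs_def)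
  from hamiltonian_flow_block[OF UW this] show ?thesis
    unfolding cmv[symmetric] by simp
qed

lemma leaf_contains_cmv:
  assumes \<alpha>: "cmv_coeffs CARD('n) \<alpha>"
  shows "hamiltonian_flow\<^sup>*\<^sup>* (cmv (\<lambda>j. if j = CARD('n) - 1 then \<alpha> j else 0)) (cmv \<alpha> :: 'n::{finite,linorder} cmat)"
proof -
  let ?n = "CARD('n)"
  \<comment> \<open>\<open>\<beta> m\<close> switches on the first m coefficients. The last one is
    kept throughout, since it must be unimodular at every stage.\<close>
  define \<beta> where "\<beta> m = (\<lambda>j. if j < m \<or> j = ?n - 1 then \<alpha> j else 0)" for m
  have "hamiltonian_flow\<^sup>*\<^sup>* (cmv (\<beta> 0)) (cmv (\<beta> m) :: 'n cmat)" if "m < ?n" for m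
    using that
  proof (induction m)
    case (Suc m)
    have "cmv_coeffs ?n (\<beta> (Suc m))"
      using \<alpha> by (simp add: cmv_coeffs_def \<beta>_def)
    moreover have "(\<beta> (Suc m))(m := 0) = \<beta> m"
      using Suc.prems by (auto simp: \<beta>_def fun_eq_iff)
    ultimately have "hamiltonian_flow (cmv (\<beta> m)) (cmv (\<beta> (Suc m)) :: 'n cmat)"
      using hamiltonian_flow_coeff[of "\<beta> (Suc m)" m, where 'n='n] Suc.prems by simp
    thus ?case using Suc by (auto intro: rtranclp.rtrancl_into_rtrancl)
  qed simp
  from this[of "?n - 1"] have "hamiltonian_flow\<^sup>*\<^sup>* (cmv (\<beta> 0)) (cmv (\<beta> (?n - 1)) :: 'n cmat)" by simp
  moreover have "cmv (\<beta> (?n - 1)) = (cmv \<alpha> :: 'n cmat)"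
    by (rule cmv_cong) (auto simp: \<beta>_def)
  ultimately show ?thesis by (simp add: \<beta>_def)
qed

section \<open>The determinant and the leaf\<close>

lemma norm_det_unitary:
  assumes "unitary A"
  shows "cmod (det A) = 1"
proof -
  have "det (adjoint_mat A) = det (transpose (adjoint_mat A))" by simp
  also have "\<dots> = cnj (det A)"
    by (simp add: det_def transpose_nth adjoint_mat_def)
  finally have "cnj (det A) * det A = 1"
    using arg_cong[OF unitaryD(1)[OF assms], of det] by (simp add: det_mul)
  hence "complex_of_real ((cmod (det A))\<^sup>2) = 1"
    by (simp only: complex_norm_square mult.commute)
  hence "(cmod (det A))\<^sup>2 = 1" by (simp only: of_real_eq_1_iff)
  thus ?thesis by (simp add: abs_square_eq_1)
qed

text \<open>A block with coefficient 0 is a swap, so \<kappa> collects the signs of n - 1 swaps, and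
  the last block contributes \<open>cnj a\<close>.\<close>

lemma det_cmv_last:
  obtains \<kappa> where "\<And>a. det (cmv (\<lambda>j. if j = CARD('n) - 1 then a else 0) :: 'n::{finite,linorder} cmat) = \<kappa> * cnj a"
proof -
  define k where "k = CARD('n) - 1"
  have kn: "Suc k = CARD('n)" by (simp add: k_def)
  let ?\<beta> = "\<lambda>a j. if j = k then a else (0::complex)"
  let ?D = "\<lambda>e \<alpha>. xi_diag (parity_below e k) \<alpha> :: 'n cmat"
  have D: "?D e (?\<beta> a) = ?D e (\<lambda>_. 0)" for e a
    by (rule xi_diag_cong) (auto simp: parity_below_def)
  have "det (xi_diag {k} (?\<beta> a) :: 'n cmat) = cnj a" for a
  proof -
    obtain e :: 'n where e: "pos e = k" using kn by (metis lessI pos_surj)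
    have le: "pos i \<le> k" for i :: 'n using pos_less_card[of i] kn by simp
    have "det (xi_diag {k} (?\<beta> a) :: 'n cmat) = (\<Prod>i\<in>UNIV. xi_diag {k} (?\<beta> a) $ i $ (i :: 'n))"
    proof (rule det_diagonal)
      fix i j :: 'n assume "i \<noteq> j"
      show "xi_diag {k} (?\<beta> a) $ i $ j = 0"
        unfolding xi_diag_nth
      proof (rule ccontr)
        assume "xi_entry {k} (?\<beta> a) (pos i) (pos j) \<noteq> 0"
        from xi_entry_support[OF this] show False
          using \<open>i \<noteq> j\<close> le[of i] le[of j] by auto
      qed
    qed
    also have "\<dots> = (\<Prod>i\<in>UNIV. if i = e then cnj a else 1)"
    proof (rule prod.cong)
      fix i :: 'n
      have "i = e \<longleftrightarrow> pos i = k" using e by (metis pos_eq_iff)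
      thus "xi_diag {k} (?\<beta> a) $ i $ i = (if i = e then cnj a else 1)"
        using le[of i] by (auto simp: xi_diag_nth xi_entry_def)
    qed simp
    finally show ?thesis by simp
  qed
  moreover have "det (cmv (?\<beta> a) :: 'n cmat) =
    det (?D True (\<lambda>_. 0)) * det (?D False (\<lambda>_. 0)) * det (xi_diag {k} (?\<beta> a) :: 'n cmat)" for a
  proof -
    have "cmv (?\<beta> a) = ?D True (?\<beta> a) ** xi_diag {k} (?\<beta> a) ** ?D False (?\<beta> a)"
      using xi_diag_absorb[of k "?\<beta> a" "mat 1 :: 'n cmat"]
      by (cases "even k") (simp_all add: cmv_eq kn[symmetric])
    thus ?thesis unfolding D by (simp add: det_mul)
  qed
  ultimately have "det (cmv (?\<beta> a) :: 'n cmat) = det (?D True (\<lambda>_. 0)) * det (?D False (\<lambda>_. 0)) * cnj a" for a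
    by simp
  thus ?thesis unfolding k_def by (rule that)
qed

lemma cmv_shape_iff: "A \<in> cmv_matrices \<longleftrightarrow> unitary A \<and> cmv_shape A"
  using cmv_matrices_of_shape unitary_cmv cmv_shape_cmv by (auto simp: cmv_matrices_def)

lemma leaf_within_cmv:
  assumes "hamiltonian_flow\<^sup>*\<^sup>* B B'" "B \<in> cmv_matrices"
  shows "B' \<in> cmv_matrices \<and> det B' = det B"
  using assms
proof (induction rule: rtranclp_induct)
  case (step B' B'')
  thus ?case using hamiltonian_flow_invariant[of B' B''] by (simp add: cmv_shape_iff)
qed simp

theorem theorem4p6:
  fixes d :: complex
  assumes "cmod d = 1"
  shows "is_symplectic_leaf {A \<in> (cmv_matrices :: ('n::{finite,linorder} cmat) set). det A = d}"
proof -
  let ?n = "CARD('n)"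
  let ?base = "\<lambda>a. cmv (\<lambda>j. if j = ?n - 1 then a else 0) :: 'n cmat"
  obtain \<kappa> where \<kappa>: "\<And>a. det (?base a) = \<kappa> * cnj a"
    using det_cmv_last by blast
  have base: "?base a \<in> cmv_matrices" if "cmod a = 1" for a
    using that by (auto simp: cmv_matrices_def cmv_coeffs_def)
  have "cmod \<kappa> = 1"
    using base[of 1] \<kappa>[of 1] norm_det_unitary[of "?base 1"] by (simp add: cmv_shape_iff)
  hence "\<kappa> \<noteq> 0" by auto
  \<comment> \<open>The solution of \<open>\<kappa> * cnj a = d\<close>; it is unimodular because
    the base point with last coefficient 1 is unitary and has determinant \<kappa>.\<close>
  define a where "a = cnj (d / \<kappa>)"
  have a: "cmod a = 1" using assms \<open>cmod \<kappa> = 1\<close> by (simp add: a_def norm_divide)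
  have deta: "det (?base a) = d" unfolding \<kappa> using \<open>\<kappa> \<noteq> 0\<close> by (simp add: a_def)
  have "{A \<in> cmv_matrices. det A = d} = symplectic_leaf (?base a)"
  proof
    show "symplectic_leaf (?base a) \<subseteq> {A \<in> cmv_matrices. det A = d}"
    proof
      fix A assume "A \<in> symplectic_leaf (?base a)"
      hence "hamiltonian_flow\<^sup>*\<^sup>* (?base a) A" unfolding symplectic_leaf_def by (rule CollectD)
      from leaf_within_cmv[OF this base[OF a]] show "A \<in> {A \<in> cmv_matrices. det A = d}"
        unfolding deta by (rule CollectI)
    qed
    show "{A \<in> cmv_matrices. det A = d} \<subseteq> symplectic_leaf (?base a)"
    proof
      fix A :: "'n cmat" assume "A \<in> {A \<in> cmv_matrices. det A = d}"
      then obtain \<alpha> where \<alpha>: "cmv_coeffs ?n \<alpha>" and A: "A = cmv \<alpha>" "det A = d"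
        by (auto simp: cmv_matrices_def)
      let ?b = "\<alpha> (?n - 1)"
      have eq: "(\<lambda>j. if j = ?n - 1 then \<alpha> j else 0) = (\<lambda>j. if j = ?n - 1 then ?b else 0)" by auto
      have flow: "hamiltonian_flow\<^sup>*\<^sup>* (?base ?b) A"
        using leaf_contains_cmv[OF \<alpha>] unfolding A(1) eq .
      have "cmod ?b = 1" using \<alpha> by (simp add: cmv_coeffs_def)
      \<comment> \<open>The flow from this base point to A preserves the determinant, so the base
        point also has determinant d, which forces its last coefficient to be a.\<close>
      hence "det (?base ?b) = d"
        using leaf_within_cmv[OF flow base] A(2) by simp
      hence "\<kappa> * cnj ?b = \<kappa> * cnj a" using deta unfolding \<kappa> by simp
      hence "cnj ?b = cnj a" using \<open>\<kappa> \<noteq> 0\<close> by simp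
      hence b: "?b = a" by (simp only: complex_cnj_cancel_iff)
      show "A \<in> symplectic_leaf (?base a)"
        using flow unfolding b symplectic_leaf_def by (rule CollectI)
    qed
  qed
  thus ?thesis unfolding is_symplectic_leaf_def by blast
qed

end
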